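(* Let $G$ be a cactus graph. Then: 1. $HG(G)=4$ if and only if $G$ contains at least two triangles. 2. $HG(G)=3$ if and only if ($G$ contains at least two cycles, or $G$ contains a cycle whose length is $4$ or divisible by $3$) and $G$ contains fewer than two triangles. 3. $HG(G)=2$ if and only if $G$ is a pseudotree with at least one edge and $G$ contains no cycle whose length is $4$ or divisible by $3$.
   Context: All graphs are finite, simple and undirected. Given a graph $G$ and a function $h:V(G)\to\mathbb{N}$ to the positive integers (the hatness function), the hat guessing game $\langle G,h\rangle$ is as follows. A coloring assigns to each vertex $v$ a color from $[h(v)]=\{1,\dots,h(v)\}$. A strategy assigns to each vertex $v$ a deterministic guessing function $f_v$ whose input is the tuple of colors of the neighbors of $v$ in $G$ and whose output is a guess in $[h(v)]$. The players win on a coloring if at least one vertex $v$ has its guess equal to its own assigned color. The game $\langle G,h\rangle$ is winning if there is a strategy for which the players win on every coloring, and losing otherwise. The hat guessing number $HG(G)$ is the largest integer $q$ such that the game $\langle G,h\rangle$ with $h(v)=q$ for all $v\in V(G)$ is winning. A cactus graph is a connected graph in which every pair of (distinct) cycles shares at most one vertex. A pseudotree is a connected graph with at most one cycle. A triangle is a cycle of length $3$. *)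

theory Defs
  imports Main "HOL-Library.FuncSet"
begin

text \<open>A graph is given by its vertex set and its set of edges, each edge being a two-element
  set of vertices.\<close>

definition simple_graph :: "'a set \<Rightarrow> 'a set set \<Rightarrow> bool" where
  "simple_graph V E \<longleftrightarrow> finite V \<and> (\<forall>e\<in>E. e \<subseteq> V \<and> card e = 2)"

definition neighbors :: "'a set set \<Rightarrow> 'a \<Rightarrow> 'a set" where
  "neighbors E v = {u. {u, v} \<in> E}"

text \<open>The empty graph does not count as connected.\<close>

definition connected_graph :: "'a set \<Rightarrow> 'a set set \<Rightarrow> bool" where
  "connected_graph V E \<longleftrightarrow>
     V \<noteq> {} \<and> (\<forall>u\<in>V. \<forall>v\<in>V. (u, v) \<in> {(x, y). {x, y} \<in> E}\<^sup>*)"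

definition closed_walk_edges :: "'a list \<Rightarrow> 'a set set" where
  "closed_walk_edges xs = {{xs ! i, xs ! (Suc i mod length xs)} | i. i < length xs}"

text \<open>A cycle is a subgraph, so traversals of it that differ in starting point or direction are
  identified: it is represented by its edge set \<open>C\<close>. Its vertices are then \<open>\<Union>C\<close>, and its
  length is \<open>card C\<close>.\<close>

definition cycles :: "'a set set \<Rightarrow> 'a set set set" where
  "cycles E = {C. C \<subseteq> E \<and>
     (\<exists>xs. distinct xs \<and> length xs \<ge> 3 \<and> C = closed_walk_edges xs)}"

definition triangles :: "'a set set \<Rightarrow> 'a set set set" where
  "triangles E = {C \<in> cycles E. card C = 3}"

definition cactus :: "'a set \<Rightarrow> 'a set set \<Rightarrow> bool" where
  "cactus V E \<longleftrightarrow> connected_graph V E \<and>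
     (\<forall>C\<in>cycles E. \<forall>D\<in>cycles E. C \<noteq> D \<longrightarrow> card (\<Union>C \<inter> \<Union>D) \<le> 1)"

definition pseudotree :: "'a set \<Rightarrow> 'a set set \<Rightarrow> bool" where
  "pseudotree V E \<longleftrightarrow> connected_graph V E \<and> card (cycles E) \<le> 1"

definition colorings :: "'a set \<Rightarrow> ('a \<Rightarrow> nat) \<Rightarrow> ('a \<Rightarrow> nat) set" where
  "colorings W h = (\<Pi>\<^sub>E v\<in>W. {1..h v})"

text \<open>The argument of the guessing function \<open>f v\<close> is a coloring of the neighbors of \<open>v\<close> only.\<close>

definition strategies ::
  "'a set \<Rightarrow> 'a set set \<Rightarrow> ('a \<Rightarrow> nat) \<Rightarrow> ('a \<Rightarrow> ('a \<Rightarrow> nat) \<Rightarrow> nat) set" where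
  "strategies V E h = {f. \<forall>v\<in>V. f v \<in> colorings (neighbors E v) h \<rightarrow> {1..h v}}"

text \<open>Intended for hatness functions \<open>h\<close> that are positive on \<open>V\<close>.\<close>

definition winning :: "'a set \<Rightarrow> 'a set set \<Rightarrow> ('a \<Rightarrow> nat) \<Rightarrow> bool" where
  "winning V E h \<longleftrightarrow> (\<exists>f\<in>strategies V E h. \<forall>c\<in>colorings V h.
     \<exists>v\<in>V. f v (restrict c (neighbors E v)) = c v)"

definition HG :: "'a set \<Rightarrow> 'a set set \<Rightarrow> nat" where
  "HG V E = (GREATEST q. q \<ge> 1 \<and> winning V E (\<lambda>_. q))"

end

theory Submission
  imports Defs "HOL-Library.Numeral_Type"
begin

text \<open>Lower bounds: two games glued at a vertex multiply the hatness there. A cycle is winning with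
  hatness 2 at one vertex and 3 elsewhere (4 elsewhere for a triangle), and an edge is winning with
  hatness 2 at both ends, so two cycles joined by a path win with 3 (two triangles with 4) everywhere.

  Upper bounds: call a game strongly losing at a vertex if it remains losing whenever the colours of
  that vertex are restricted to two. A strongly losing subgraph hanging at a cycle vertex then
  forbids a single colour once the two cycle neighbours are coloured, so it acts like one guess of
  that vertex. Removing the edges of a cycle, or a bridge, from a cactus therefore reduces the
  whole game to the game on that cycle.

  For the cycle of length \<open>n\<close> with three colours, regard a colouring of which no guess is right as a
  closed walk through the pairs of colours on consecutive edges. If there is none, a double count
  forces the out-degree and the in-degree of every pair to add up to 4. A pair of out-degree 1 is
  followed by another one; following such pairs for several rounds determines the strategy
  up to renaming of colours and yields \<open>3 dvd n\<close> or \<open>n = 4\<close>. If there is no such pair, every guess is a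
  Latin square and five steps reach all pairs.\<close>

section \<open>Cycles with three colours\<close>

text \<open>Strong losing and the glued winning games are two sides of one condition: up to renaming
  colours, a cycle fails to be strongly losing at a vertex exactly if it wins with hatness 2 there.
  To lose for two given root colours, it suffices to colour the two cycle neighbours of the root so
  that the rest of the cycle can guess wrong for both. Each root colour spoils at most 2q pairs of
  neighbour colours on a triangle, and at most 2q - 1 on a longer cycle, out of q * q pairs. As 4q <
  q * q needs q at least 5, whereas 4q - 2 < q * q holds already for q = 4, triangles are strongly
  losing from 5 colours on and longer cycles from 4 on; with 3 colours no cycle is. One exceptional
  cycle is harmless, since the reduction may end at it and then only needs it to lose. Hence two
  triangles decide about 4, and two arbitrary cycles about 3. The hard case left over is a single
  cycle with three colours: there counting right guesses is too coarse, and the strategy itself has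
  to be recovered.\<close>

lemma exhaust_three: "(x::3) = 0 \<or> x = 1 \<or> x = 2"
proof (induct x)
  case (of_int z)
  then have "z = 0 \<or> z = 1 \<or> z = 2" by (simp, arith)
  then show ?case by auto
qed

lemma neq_3 [simp]: "(0::3) \<noteq> 1" "(0::3) \<noteq> 2" "(1::3) \<noteq> 2" "(1::3) \<noteq> 0" "(2::3) \<noteq> 0" "(2::3) \<noteq> 1"
  by simp_all

lemma third_colour: "\<exists>c::3. c \<noteq> a \<and> c \<noteq> b"
  by (metis exhaust_three neq_3)

lemma three_colours:
  fixes a b c d :: 3
  assumes "a \<noteq> b" "c \<noteq> a" "c \<noteq> b"
  shows "d = a \<or> d = b \<or> d = c"
  using assms exhaust_three[of a] exhaust_three[of b] exhaust_three[of c] exhaust_three[of d] by auto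

lemma card_3:
  fixes a b c :: 3
  assumes "a \<noteq> b" "c \<noteq> a" "c \<noteq> b"
  shows "card {x. P x} = of_bool (P a) + of_bool (P b) + of_bool (P c)"
proof -
  have U: "UNIV = {a, b, c}" using three_colours[OF assms] by auto
  have "card {x. P x} = (\<Sum>x\<in>UNIV. of_bool (P x))" by simp
  also have "\<dots> = of_bool (P a) + of_bool (P b) + of_bool (P c)"
    unfolding U using assms by simp
  finally show ?thesis .
qed

lemma card_le_one_ex:
  fixes P :: "3 \<Rightarrow> bool"
  assumes "card {x. P x} \<le> 1"
  shows "\<exists>x0. \<forall>x. P x \<longrightarrow> x = x0"
proof (cases "\<exists>a. P a")
  case True
  then obtain a where "P a" by blast
  then have "\<forall>x. P x \<longrightarrow> x = a" using assms by (simp add: card_le_Suc0_iff_eq)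
  then show ?thesis by blast
qed simp

lemma card_1_ex1:
  assumes "card {x. P x} = 1"
  shows "\<exists>!x. P x"
proof -
  obtain y where "{x. P x} = {y}" using card_1_singletonE[OF assms] by blast
  then show ?thesis by (metis mem_Collect_eq singleton_iff)
qed

lemma sum_fibres: "(\<Sum>t\<in>UNIV. card {b. f b = t}) = 3" for f :: "3 \<Rightarrow> 3"
proof -
  have "(\<Sum>t\<in>UNIV. card {b. f b = t}) = card (\<Union>t\<in>UNIV. {b. f b = t})"
    by (subst card_UN_disjoint) auto
  also have "(\<Union>t\<in>UNIV. {b. f b = t}) = UNIV" by auto
  finally show ?thesis by simp
qed

lemma period_mod:
  fixes x :: "nat \<Rightarrow> 'b" and k n :: nat
  assumes "\<And>i. x (i + k * n) = x i"
  shows "x (i + m * n) = x (i + (m mod k) * n)"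
proof -
  have per: "x (i + j * (k * n)) = x i" for i j
  proof (induction j)
    case (Suc j)
    have "i + Suc j * (k * n) = (i + j * (k * n)) + k * n" by simp
    then show ?case using Suc assms by presburger
  qed simp
  have "m * n = (m mod k + m div k * k) * n" by simp
  then have "i + m * n = (i + (m mod k) * n) + (m div k) * (k * n)"
    by (simp only: add_mult_distrib mult.assoc add.assoc)
  then show ?thesis using per by presburger
qed

text \<open>Indices are shifted: \<open>g i\<close> is the guess of vertex \<open>i + 1\<close>, which sees \<open>i\<close> and \<open>i + 2\<close>.\<close>

definition walk :: "(nat \<Rightarrow> 3 \<Rightarrow> 3 \<Rightarrow> 3) \<Rightarrow> nat \<Rightarrow> nat \<Rightarrow> 3 \<Rightarrow> 3 \<Rightarrow> 3 \<Rightarrow> 3 \<Rightarrow> bool" where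
  "walk g i k s t b e \<longleftrightarrow> (\<exists>p. p 0 = s \<and> p 1 = t \<and> p k = b \<and> p (Suc k) = e \<and>
     (\<forall>j<k. g (i + j) (p j) (p (Suc (Suc j))) \<noteq> p (Suc j)))"

lemma walkI:
  assumes "p 0 = s" "p 1 = t" "p k = b" "p (Suc k) = e"
    "\<And>j. j < k \<Longrightarrow> g (i + j) (p j) (p (Suc (Suc j))) \<noteq> p (Suc j)"
  shows "walk g i k s t b e"
  using assms unfolding walk_def by blast

lemma walk_1: "walk g i 1 s t b e \<longleftrightarrow> b = t \<and> g i s e \<noteq> t"
proof
  assume "b = t \<and> g i s e \<noteq> t"
  then show "walk g i 1 s t b e"
    by (intro walkI[where p="\<lambda>j. if j = 0 then s else if j = 1 then t else e"]) auto
qed (auto simp: walk_def)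

lemma walk_snoc:
  assumes "walk g i k s t b c" "g (i + k) b d \<noteq> c"
  shows "walk g i (Suc k) s t c d"
proof -
  obtain p where p: "p 0 = s" "p 1 = t" "p k = b" "p (Suc k) = c"
     "\<forall>j<k. g (i + j) (p j) (p (Suc (Suc j))) \<noteq> p (Suc j)"
    using assms(1) unfolding walk_def by blast
  show ?thesis
    by (rule walkI[where p="p(Suc (Suc k) := d)"]) (use p assms(2) in \<open>auto simp: less_Suc_eq\<close>)
qed

lemma walk_snoc':
  assumes "walk g i k s t b c" "g m b d \<noteq> c" "m = i + k" "k' = Suc k"
  shows "walk g i k' s t c d"
  using walk_snoc assms by blast

lemma walk_Cons:
  assumes "walk g (Suc i) k t c b e" "g i s c \<noteq> t"
  shows "walk g i (Suc k) s t b e"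
proof -
  obtain p where p: "p 0 = t" "p 1 = c" "p k = b" "p (Suc k) = e"
     "\<forall>j<k. g (Suc i + j) (p j) (p (Suc (Suc j))) \<noteq> p (Suc j)"
    using assms(1) unfolding walk_def by blast
  show ?thesis
  proof (rule walkI[where p="case_nat s p"])
    fix j assume "j < Suc k"
    then show "g (i + j) (case_nat s p j) (case_nat s p (Suc (Suc j))) \<noteq> case_nat s p (Suc j)"
      using p assms(2) by (cases j) auto
  qed (use p in auto)
qed

text \<open>Induction at the far end. Each of the two colours other than \<open>b0\<close> can be
  preceded by at least two colours; if \<open>e\<close> could be appended to none of these walks,
  the map sending \<open>b\<close> to the guess between \<open>b\<close> and \<open>e\<close> would
  have two disjoint fibres of size two in a set of three.\<close>

lemma walk_last: "\<exists>t b. b \<noteq> b0 \<and> walk g i (Suc k) s t b e"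
proof (induction k arbitrary: b0 e)
  case 0
  obtain t where "t \<noteq> b0" "t \<noteq> g i s e" using third_colour by blast
  then show ?case using walk_1[of g i s t t e] by (auto simp: eq_commute)
next
  case (Suc k)
  show ?case
  proof (rule ccontr)
    assume neg: "\<not> ?thesis"
    have *: "g (i + Suc k) b e = c" if "walk g i (Suc k) s t b c" "c \<noteq> b0" for t b c
      using neg that walk_snoc by blast
    obtain c1 where c1: "c1 \<noteq> b0" using third_colour by blast
    obtain c2 where c2: "c2 \<noteq> b0" "c2 \<noteq> c1" using third_colour by blast
    obtain t b where b: "walk g i (Suc k) s t b c1" using Suc.IH by blast
    obtain t' b' where b': "walk g i (Suc k) s t' b' c1" "b' \<noteq> b" using Suc.IH by blast
    obtain t2 d where d: "walk g i (Suc k) s t2 d c2" using Suc.IH by blast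
    obtain t2' d' where d': "walk g i (Suc k) s t2' d' c2" "d' \<noteq> d" using Suc.IH by blast
    have "g (i + Suc k) b e = c1" "g (i + Suc k) b' e = c1" "g (i + Suc k) d e = c2" "g (i + Suc k) d' e = c2"
      using * b b' d d' c1 c2 by blast+
    then have "d \<noteq> b" "d \<noteq> b'" "d' \<noteq> b" "d' \<noteq> b'" using c2 by auto
    then show False using three_colours[of b b' d d'] b' d' by auto
  qed
qed

text \<open>Mirror image of \<open>walk_last\<close>: the induction prepends a colour, so the fibres
  are those of the guess in its right argument.\<close>

lemma walk_first: "\<exists>t b. t \<noteq> t0 \<and> walk g i (Suc k) s t b e"
proof (induction k arbitrary: i t0 s)
  case 0
  obtain t where "t \<noteq> t0" "t \<noteq> g i s e" using third_colour by blast
  then show ?case using walk_1[of g i s t t e] by (auto simp: eq_commute)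
next
  case (Suc k)
  show ?case
  proof (rule ccontr)
    assume neg: "\<not> ?thesis"
    have *: "g i s c = t" if "walk g (Suc i) (Suc k) t c b e" "t \<noteq> t0" for t b c
      using neg that walk_Cons by blast
    obtain c1 where c1: "c1 \<noteq> t0" using third_colour by blast
    obtain c2 where c2: "c2 \<noteq> t0" "c2 \<noteq> c1" using third_colour by blast
    obtain t b where b: "walk g (Suc i) (Suc k) c1 b t e" using Suc.IH by blast
    obtain t' b' where b': "walk g (Suc i) (Suc k) c1 b' t' e" "b' \<noteq> b" using Suc.IH by blast
    obtain t2 d where d: "walk g (Suc i) (Suc k) c2 d t2 e" using Suc.IH by blast
    obtain t2' d' where d': "walk g (Suc i) (Suc k) c2 d' t2' e" "d' \<noteq> d" using Suc.IH by blast
    have "g i s b = c1" "g i s b' = c1" "g i s d = c2" "g i s d' = c2"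
      using * b b' d d' c1 c2 by blast+
    then have "d \<noteq> b" "d \<noteq> b'" "d' \<noteq> b" "d' \<noteq> b'" using c2 by auto
    then show False using three_colours[of b b' d d'] b' d' by auto
  qed
qed

section \<open>Degrees of colour pairs when no walk closes up\<close>

locale no_closed_walk =
  fixes g :: "nat \<Rightarrow> 3 \<Rightarrow> 3 \<Rightarrow> 3" and n :: nat
  assumes per: "g (i + n) = g i"
    and n_ge: "n \<ge> 5"
    and none: "\<not> walk g i n s t s t"
begin

text \<open>Both count blocked extensions. The out-degree of a pair in the overview is 3 minus
  \<open>fwd\<close>, its in-degree 3 minus \<open>bwd\<close>; out-degree 1 thus reads
  \<open>fwd i s t = 2\<close>.\<close>

abbreviation fwd where "fwd i s t \<equiv> card {b. g i s b = t}"
abbreviation bwd where "bwd i t b \<equiv> card {s. g i s b = t}"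

lemma walk_period: "walk g (i + n) = walk g i"
proof -
  have "g (i + n + j) = g (i + j)" for j using per[of "i + j"] by (simp add: ac_simps)
  then show ?thesis unfolding walk_def by presburger
qed

text \<open>A walk through n - 2 vertices leaves open the guesses of two adjacent vertices, those
  coloured \<open>s\<close> and \<open>t\<close>. If both were wrong, the walk would close
  up.\<close>

lemma path_covered:
  assumes "walk g (Suc (Suc i)) (n - 2) t b e s"
  shows "g (Suc i) s b = t \<or> g i e t = s"
proof (rule ccontr)
  assume neg: "\<not> ?thesis"
  have n: "Suc (n - 2) = n - 1" "Suc (n - 1) = n" "Suc i + (n - 1) = i + n" using n_ge by auto
  have "walk g (Suc i) (n - 1) s t e s" using walk_Cons[OF assms] neg n by metis
  then have "walk g (Suc i) n s t s t" using walk_snoc[of g "Suc i" "n-1" s t e s t] neg n per by metis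
  then show False using none by blast
qed

text \<open>If the two counts add up to at most 1, one is 0 and the other excludes at most one
  colour. \<open>walk_first\<close> or \<open>walk_last\<close> supplies a walk avoiding that
  colour, against \<open>path_covered\<close>.\<close>

lemma fwd_bwd_ge: "fwd (Suc i) s t + bwd i s t \<ge> 2"
proof (rule ccontr)
  assume "\<not> ?thesis"
  then have lt: "fwd (Suc i) s t + bwd i s t \<le> 1" by auto
  obtain k where k: "n - 2 = Suc k" using n_ge by (cases "n - 2") auto
  show False
  proof (cases "fwd (Suc i) s t = 0")
    case True
    then have 1: "g (Suc i) s b \<noteq> t" for b by auto
    have "bwd i s t \<le> 1" using lt by auto
    from card_le_one_ex[OF this] obtain e0 where e0: "\<And>e. g i e t = s \<Longrightarrow> e = e0" by blast
    obtain b e where "e \<noteq> e0" "walk g (Suc (Suc i)) (n - 2) t b e s" using walk_last k by metis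
    then show False using path_covered 1 e0 by blast
  next
    case False
    then have "bwd i s t = 0" "fwd (Suc i) s t \<le> 1" using lt by linarith+
    then have 1: "g i e t \<noteq> s" for e by auto
    obtain b0 where b0: "\<And>b. g (Suc i) s b = t \<Longrightarrow> b = b0" using card_le_one_ex[OF \<open>fwd (Suc i) s t \<le> 1\<close>] by blast
    obtain b e where "b \<noteq> b0" "walk g (Suc (Suc i)) (n - 2) t b e s" using walk_first k by metis
    then show False using path_covered 1 b0 by blast
  qed
qed

text \<open>Summed over the nine pairs, each count gives 9, since the fibres of a guess partition
  the three colours. Nine terms of at least 2 that add up to 18 all equal 2.\<close>

lemma fwd_bwd: "fwd (Suc i) s t + bwd i s t = 2"
proof -
  define f where "f s t = fwd (Suc i) s t + bwd i s t" for s t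
  have ge: "2 \<le> f s t" for s t unfolding f_def by (rule fwd_bwd_ge)
  have le: "6 \<le> (\<Sum>t\<in>UNIV. f s t)" for s
    using sum_mono[of UNIV "\<lambda>_. 2" "f s"] ge by simp
  have "(\<Sum>s\<in>UNIV. \<Sum>t\<in>UNIV. f s t) = (\<Sum>s\<in>UNIV. \<Sum>t\<in>UNIV. fwd (Suc i) s t) + (\<Sum>s\<in>UNIV. \<Sum>t\<in>UNIV. bwd i s t)"
    unfolding f_def by (simp only: sum.distrib)
  also have "(\<Sum>s\<in>UNIV. \<Sum>t\<in>UNIV. bwd i s t) = (\<Sum>t\<in>UNIV. \<Sum>s\<in>UNIV. bwd i s t)"
    by (rule sum.swap)
  finally have "(\<Sum>s\<in>(UNIV :: 3 set). 6) = (\<Sum>s\<in>UNIV. \<Sum>t\<in>UNIV. f s t)"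
    by (simp add: sum_fibres)
  then have "6 = (\<Sum>t\<in>UNIV. f s t)"
    using sum_mono_inv[of "\<lambda>_. 6" UNIV "\<lambda>s. \<Sum>t\<in>UNIV. f s t" s] le by simp
  then have "(\<Sum>t\<in>(UNIV :: 3 set). 2) = (\<Sum>t\<in>UNIV. f s t)" by simp
  then have "2 = f s t" using sum_mono_inv[of "\<lambda>_. 2" UNIV "f s" t] ge by simp
  then show ?thesis unfolding f_def by simp
qed

text \<open>\<open>i + n - 1\<close> is the predecessor of \<open>i\<close> modulo \<open>n\<close>,
  so that \<open>i = 0\<close> is covered as well.\<close>

lemma fwd_bwd': "fwd i s t + bwd (i + n - 1) s t = 2"
  using fwd_bwd[of "i + n - 1" s t] n_ge per by simp

lemma sum_fwd: "(\<Sum>t\<in>UNIV. fwd i s t) = 3"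
  by (rule sum_fibres)

text \<open>Column sums of \<open>fwd\<close> are not sums over fibres; they are inherited from
  \<open>bwd\<close> through \<open>fwd_bwd'\<close>. Rows and columns of sum 3 contain the entry 2
  at most once.\<close>

lemma sum_fwd': "(\<Sum>s\<in>UNIV. fwd i s t) = 3"
proof -
  have "(\<Sum>s\<in>UNIV. fwd i s t + bwd (i + n - 1) s t) = 6" by (simp add: fwd_bwd' del: One_nat_def)
  then show ?thesis using sum_fibres[of "\<lambda>e. g (i + n - 1) e t"] by (simp add: sum.distrib)
qed

lemma fwd_le: "fwd i s t \<le> 2"
  using fwd_bwd'[of i s t] by linarith

lemma sum_3: "(\<Sum>x\<in>UNIV. f x) = f a + f b + f c" if "a \<noteq> b" "c \<noteq> a" "c \<noteq> b" for f :: "3 \<Rightarrow> nat"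
proof -
  have U: "UNIV = {a, b, c}" using three_colours[OF that] by auto
  show ?thesis unfolding U using that by simp
qed

lemma fwd2_unique_right: "fwd i s t = 2 \<Longrightarrow> fwd i s t' = 2 \<Longrightarrow> t = t'"
proof (rule ccontr)
  assume *: "fwd i s t = 2" "fwd i s t' = 2" "t \<noteq> t'"
  obtain u where "u \<noteq> t" "u \<noteq> t'" using third_colour by blast
  then show False using sum_fwd[of i s] sum_3[of t t' u "fwd i s"] * by simp
qed

lemma fwd2_unique_left: "fwd i s t = 2 \<Longrightarrow> fwd i s' t = 2 \<Longrightarrow> s = s'"
proof (rule ccontr)
  assume *: "fwd i s t = 2" "fwd i s' t = 2" "s \<noteq> s'"
  obtain u where "u \<noteq> s" "u \<noteq> s'" using third_colour by blast
  then show False using sum_fwd'[of i t] sum_3[of s s' u "\<lambda>s. fwd i s t"] * by simp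
qed

lemma fwd2_succ: assumes "fwd i s t = 2" shows "\<exists>c. \<forall>b. g i s b = t \<longleftrightarrow> b \<noteq> c"
proof -
  obtain x y where xy: "{b. g i s b = t} = {x, y}" "x \<noteq> y" using assms by (auto simp: card_2_iff)
  obtain c where "c \<noteq> x" "c \<noteq> y" using third_colour by blast
  then have "\<forall>b. g i s b = t \<longleftrightarrow> b \<noteq> c" using xy three_colours[of x y c] by blast
  then show ?thesis by blast
qed

text \<open>\<open>fwd i s t = 2\<close> makes the \<open>bwd\<close> of this pair 0, so every
  colour may precede it. Were at most one continuation of \<open>(t, c)\<close> blocked,
  \<open>walk_first\<close> would lead on from there back to \<open>s\<close>, and neither
  alternative of \<open>path_covered\<close> could hold.\<close>

lemma fwd2_step:
  assumes 2: "fwd i s t = 2" and c: "g i s c \<noteq> t"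
  shows "fwd (Suc i) t c = 2"
proof (rule ccontr)
  assume neg: "\<not> ?thesis"
  then have "fwd (Suc i) t c \<le> 1" using fwd_le[of "Suc i" t c] by linarith
  from card_le_one_ex[OF this] obtain d0 where d0: "\<And>d. g (Suc i) t d = c \<Longrightarrow> d = d0" by blast
  have k: "n - 3 = Suc (n - 4)" "n - 2 = Suc (n - 3)" using n_ge by auto
  obtain d e where d: "d \<noteq> d0" "walk g (Suc (Suc i)) (n - 3) c d e s"
    using walk_first[of d0 g "Suc (Suc i)" "n-4" c s] k by metis
  then have "walk g (Suc i) (n - 2) t c e s" using walk_Cons[of g "Suc i" "n-3" c d e s t] d0 k by metis
  then have "walk g (Suc i + n) (n - 2) t c e s" by (simp only: walk_period)
  then have "walk g (Suc (Suc (i + n - 1))) (n - 2) t c e s" using n_ge by simp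
  then have "g i s c = t \<or> g (i + n - 1) e t = s" using path_covered[of "i + n - 1"] n_ge per by simp
  moreover have "bwd (i + n - 1) s t = 0" using fwd_bwd'[of i s t] 2 by simp
  ultimately show False using c by auto
qed


section \<open>The forced walk through pairs of out-degree 1\<close>

text \<open>The sequence is indexed by all naturals because the forced walk need not return to its
  colours after one round; its successive rounds are compared in \<open>fwd2_dvd\<close>.\<close>

lemma fwd2_sequence:
  assumes "fwd 0 s t = 2"
  shows "\<exists>x. \<forall>i. fwd i (x i) (x (Suc i)) = 2 \<and> (\<forall>b. g i (x i) b = x (Suc i) \<longleftrightarrow> b \<noteq> x (Suc (Suc i)))"
proof -
  let ?P = "\<lambda>i st. fwd i (fst st) (snd st) = 2 \<and> (i = 0 \<longrightarrow> st = (s, t))"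
  let ?Q = "\<lambda>i st st'. fst st' = snd st \<and> (\<forall>b. g i (fst st) b = snd st \<longleftrightarrow> b \<noteq> snd st')"
  have "\<exists>z. \<forall>i. ?P i (z i) \<and> ?Q i (z i) (z (Suc i))"
  proof (rule dependent_nat_choice)
    show "\<exists>st. ?P 0 st" using assms by (intro exI[of _ "(s, t)"]) simp
    fix st i assume st: "?P i st"
    obtain c where c: "\<forall>b. g i (fst st) b = snd st \<longleftrightarrow> b \<noteq> c" using fwd2_succ st by blast
    then have "fwd (Suc i) (snd st) c = 2" using fwd2_step st by blast
    then show "\<exists>st'. ?P (Suc i) st' \<and> ?Q i st st'" using c by (intro exI[of _ "(snd st, c)"]) simp
  qed
  then obtain z where z: "\<And>i. ?P i (z i)" "\<And>i. ?Q i (z i) (z (Suc i))" by blast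
  have f: "fst (z (Suc i)) = snd (z i)" for i using z(2) by blast
  show ?thesis
  proof (intro exI[of _ "\<lambda>i. fst (z i)"] allI conjI)
    fix i
    show "fwd i (fst (z i)) (fst (z (Suc i))) = 2" using z(1) f by simp
    show "g i (fst (z i)) b = fst (z (Suc i)) \<longleftrightarrow> b \<noteq> fst (z (Suc (Suc i)))" for b
      using z(2)[of i] by (simp add: f)
  qed
qed

lemma per_mult: "g (i + k * n) = g i"
proof (induction k)
  case (Suc k)
  then show ?case using per[of "i + k * n"] by (simp add: algebra_simps)
qed simp

lemma no_closed_sequence:
  assumes "p n = p 0" "p (Suc n) = p 1"
  shows "\<exists>j<n. g (i + j) (p j) (p (Suc (Suc j))) = p (Suc j)"
proof (rule ccontr)
  assume "\<not> ?thesis"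
  then have "walk g i n (p 0) (p 1) (p 0) (p 1)"
    by (intro walkI[where p=p]) (use assms in auto)
  then show False using none by blast
qed

text \<open>Forced pairs propagate forwards only, so index 0 is reached by going on to the multiple
  \<open>i * n\<close>.\<close>

lemma fwd2_at_0:
  assumes "fwd i s t = 2"
  shows "\<exists>s t. fwd 0 s t = 2"
proof -
  have "\<exists>s t. fwd (i + k) s t = 2" for k
  proof (induction k)
    case (Suc k)
    then show ?case using fwd2_succ fwd2_step by (metis add_Suc_right)
  qed (use assms in auto)
  from this[of "i * n - i"] have "\<exists>s t. fwd (i * n) s t = 2" using n_ge by (cases n) auto
  then show ?thesis using per_mult[of 0 i] by simp
qed

text \<open>Shifting the forced walk \<open>x\<close> by whole rounds gives forced walks again, and
  two of them that agree once agree from then on. One round never returns, so the shifts have period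
  2 or 3. With period 3, any \<open>n\<close> not divisible by 3 admits a closed walk; with period 2
  the guesses are determined completely, and a closed walk exists for every \<open>n\<close> at
  least 5.\<close>

lemma fwd2_dvd:
  assumes "fwd i s t = 2"
  shows "3 dvd n"
proof -
  obtain s t where "fwd 0 s t = 2" using fwd2_at_0 assms by blast
  from fwd2_sequence[OF this] obtain x where x2: "\<And>i. fwd i (x i) (x (Suc i)) = 2"
    and xg: "\<And>i b. g i (x i) b = x (Suc i) \<longleftrightarrow> b \<noteq> x (Suc (Suc i))"
    by blast
  have x2m: "fwd i (x (i + k * n)) (x (Suc i + k * n)) = 2" for i k
    using x2[of "i + k * n"] per_mult[of i k] by simp
  have xgm: "g i (x (i + k * n)) b = x (Suc i + k * n) \<longleftrightarrow> b \<noteq> x (Suc (Suc i) + k * n)" for i k b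
    using xg[of "i + k * n"] per_mult[of i k] by simp
  have ne1: "x (i + n) \<noteq> x i" for i
  proof
    assume eq: "x (i + n) = x i"
    have "x (Suc i + n) = x (Suc i)"
      by (rule fwd2_unique_right[of i "x i"]) (use x2[of i] x2m[of i 1] eq in simp_all)
    then show False
      using no_closed_sequence[of "\<lambda>j. x (i + j)" i] eq xg by auto
  qed
  show ?thesis
  proof (cases "\<forall>i. x (i + 2 * n) = x i")
    case False
    have "x (i + 2 * n) = x i \<longleftrightarrow> x (Suc i + 2 * n) = x (Suc i)" for i
    proof
      assume eq: "x (i + 2 * n) = x i"
      show "x (Suc i + 2 * n) = x (Suc i)"
        by (rule fwd2_unique_right[of i "x i"]) (use x2[of i] x2m[of i 2] eq in simp_all)
    next
      assume eq: "x (Suc i + 2 * n) = x (Suc i)"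
      show "x (i + 2 * n) = x i"
        by (rule fwd2_unique_left[of i _ "x (Suc i)"]) (use x2[of i] x2m[of i 2] eq in simp_all)
    qed
    then have "x (i + 2 * n) = x i \<longleftrightarrow> x (0 + 2 * n) = x 0" for i
      by (induction i) auto
    then have ne2: "x (i + 2 * n) \<noteq> x i" for i using False by blast
    have per3: "x (i + 3 * n) = x i" for i
    proof -
      have e: "i + n + n = i + 2 * n" "i + 2 * n + n = i + 3 * n" "i + n + 2 * n = i + 3 * n" by simp_all
      show ?thesis
        using three_colours[of "x (i + n)" "x (i + 2 * n)" "x i" "x (i + 3 * n)"]
          ne1[of i] ne1[of "i + n"] ne1[of "i + 2 * n"] ne2[of i] ne2[of "i + n"]
        unfolding e by metis
    qed
    note mod3 = period_mod[of x 3 n, OF per3]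
    show ?thesis
    proof (rule ccontr)
      assume "\<not> 3 dvd n"
      then have "n mod 3 = 1 \<or> n mod 3 = 2" by presburger
      moreover have "(1 + 2 * n) mod 3 = 0" if "n mod 3 = 1" using that by presburger
      moreover have "(1 + 1 * n) mod 3 = 0" if "n mod 3 = 2" using that by presburger
      ultimately obtain d where d: "d = 1 \<or> d = 2" "(1 + d * n) mod 3 = 0" by metis
      \<comment> \<open>\<open>u\<close> switches to the walk \<open>d\<close> rounds later at every
        step. Two steps ahead it has left the round used at \<open>j\<close>, so the guess stays in
        that round while \<open>u\<close> has moved on. It closes up because
        \<open>u (n + i)\<close> lies 1 + d n rounds beyond \<open>u i\<close>.\<close>
      define u where "u i = x (i + d * i * n)" for i
      have "u (n + i) = u i" for i
      proof -
        have "u (n + i) = x (i + (d * i + (1 + d * n)) * n)"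
          unfolding u_def by (simp add: algebra_simps)
        also have "\<dots> = x (i + (d * i + (1 + d * n)) mod 3 * n)" by (rule mod3)
        also have "(d * i + (1 + d * n)) mod 3 = (d * i) mod 3"
          using d(2) by (metis add.right_neutral mod_add_right_eq)
        also have "x (i + (d * i) mod 3 * n) = x (i + (d * i) * n)" by (rule mod3[symmetric])
        finally show ?thesis by (simp add: u_def)
      qed
      then obtain j where j: "g j (u j) (u (Suc (Suc j))) = u (Suc j)"
        using no_closed_sequence[of u 0] by (metis add.right_neutral add_0 add_Suc_right One_nat_def)
      have ne: "x (i + d * n) \<noteq> x i" "x (i + (2 * d) * n) \<noteq> x i" for i
        using d(1) ne1[of i] ne2[of i] mod3[of i 4] by auto
      have "u (Suc (Suc j)) = x ((Suc (Suc j) + d * j * n) + (2 * d) * n)" "u (Suc j) = x ((Suc j + d * j * n) + d * n)"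
        unfolding u_def by (simp_all add: algebra_simps mult_2_right)
      then have u: "u (Suc (Suc j)) \<noteq> x (Suc (Suc j) + d * j * n)" "u (Suc j) \<noteq> x (Suc j + d * j * n)"
        using ne by metis+
      then have "g j (u j) (u (Suc (Suc j))) = x (Suc j + d * j * n)"
        unfolding u_def[of j] xgm by blast
      then show False using j u by metis
    qed
  next
    case True
    have parity: "x (i + k * n) = (if even k then x i else x (i + n))" for i k
    proof -
      have "x (i + k * n) = x (i + (k mod 2) * n)" using period_mod[of x 2 n] True by blast
      then show ?thesis by (simp add: mod2_eq_if)
    qed
    have "\<exists>z. \<forall>i. z i \<noteq> x i \<and> z i \<noteq> x (i + n)"
      by (intro choice allI third_colour)
    then obtain z where z: "\<And>i. z i \<noteq> x i" "\<And>i. z i \<noteq> x (i + n)" by blast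
    have zper: "z (i + n) = z i" for i
    proof -
      have "x (i + n + n) = x i" using True[rule_format, of i] by (simp add: mult_2 add.assoc)
      then show ?thesis
        using three_colours[of "x i" "x (i + n)" "z i" "z (i + n)"] z[of i] z[of "i + n"] ne1[of i] by metis
    qed
    have third: "c = z i" if "c \<noteq> x i" "c \<noteq> x (i + n)" for c i
      using three_colours[of "x i" "x (i + n)" "z i" c] z[of i] ne1[of i] that by auto
    have y2: "fwd i (x (i + n)) (x (Suc i + n)) = 2" for i using x2m[of i 1] by simp
    have yg: "g i (x (i + n)) b = x (Suc i + n) \<longleftrightarrow> b \<noteq> x (Suc (Suc i) + n)" for i b using xgm[of i 1] by simp
    \<comment> \<open>Otherwise the third colours \<open>z\<close> would form a forced walk too: by
      uniqueness in each column, their continuation differs from those of both rounds of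
      \<open>x\<close>. But \<open>z\<close> returns after one round.\<close>
    have z2: "fwd i (z i) (z (Suc i)) \<noteq> 2" for i
    proof
      assume 0: "fwd i (z i) (z (Suc i)) = 2"
      have step: "g j (z j) (z (Suc (Suc j))) \<noteq> z (Suc j) \<and> fwd (Suc j) (z (Suc j)) (z (Suc (Suc j))) = 2"
        if 2: "fwd j (z j) (z (Suc j)) = 2" for j
      proof -
        obtain c where c: "\<And>b. g j (z j) b = z (Suc j) \<longleftrightarrow> b \<noteq> c" using fwd2_succ[OF 2] by blast
        then have c2: "fwd (Suc j) (z (Suc j)) c = 2" using fwd2_step[OF 2] by blast
        have "c \<noteq> x (Suc (Suc j))" "c \<noteq> x (Suc (Suc j) + n)"
          using fwd2_unique_left[OF c2] x2[of "Suc j"] y2[of "Suc j"] z[of "Suc j"] by auto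
        then have "c = z (Suc (Suc j))" by (rule third)
        then show ?thesis using c c2 by auto
      qed
      have "fwd (i + k) (z (i + k)) (z (Suc (i + k))) = 2" for k
        by (induction k) (use 0 step in auto)
      then show False
        using no_closed_sequence[of "\<lambda>j. z (i + j)" i] step zper[of i] zper[of "Suc i"] by auto
    qed
    \<comment> \<open>Write a, b, z for the colours given by \<open>x\<close>, by its next round and
      by \<open>z\<close>. Right of a the guess is a unless followed by a, and likewise for b.
      Before a the guess is never a, as \<open>bwd\<close> is 0 there. The pair of third colours has
      positive \<open>bwd\<close>, which only the left neighbour z can provide. Column sums, and at
      most one blocked continuation for the pair of third colours, fix the remaining four
      entries.\<close>
    have tab: "g i (x i) (x (Suc (Suc i))) = z (Suc i)" "g i (x (i + n)) (x (Suc (Suc i) + n)) = z (Suc i)"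
      "g i (z i) (x (Suc (Suc i))) = x (Suc i + n)" "g i (z i) (x (Suc (Suc i) + n)) = x (Suc i)"
      "g i (z i) (z (Suc (Suc i))) = z (Suc i)" for i
    proof -
      define a0 b0 z0 where "a0 = x i" "b0 = x (i + n)" "z0 = z i"
      define a1 b1 z1 where "a1 = x (Suc i)" "b1 = x (Suc i + n)" "z1 = z (Suc i)"
      define a2 b2 z2 where "a2 = x (Suc (Suc i))" "b2 = x (Suc (Suc i) + n)" "z2 = z (Suc (Suc i))"
      note defs = a0_b0_z0_def a1_b1_z1_def a2_b2_z2_def
      have d0: "a0 \<noteq> b0" "z0 \<noteq> a0" "z0 \<noteq> b0" and d1: "a1 \<noteq> b1" "z1 \<noteq> a1" "z1 \<noteq> b1" and d2: "a2 \<noteq> b2" "z2 \<noteq> a2" "z2 \<noteq> b2"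
        unfolding defs using z ne1 by metis+
      have ga: "g i a0 q = a1 \<longleftrightarrow> q \<noteq> a2" and gb: "g i b0 q = b1 \<longleftrightarrow> q \<noteq> b2" for q
        unfolding defs using xg yg by auto
      have "fwd (Suc i) a1 a2 = 2" "fwd (Suc i) b1 b2 = 2" "fwd (Suc i) z1 z2 \<noteq> 2" and
        f0: "fwd i a0 a1 = 2" "fwd i b0 b1 = 2" "fwd i z0 z1 \<noteq> 2"
        unfolding defs by (rule x2 y2 z2)+
      then have "bwd i a1 a2 = 0" "bwd i b1 b2 = 0" "bwd i z1 z2 \<noteq> 0"
        using fwd_bwd[of i a1 a2] fwd_bwd[of i b1 b2] fwd_bwd[of i z1 z2] by linarith+
      then have na: "\<And>s. g i s a2 \<noteq> a1" and nb: "\<And>s. g i s b2 \<noteq> b1" and "\<exists>s. g i s z2 = z1"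
        by auto
      then have gzz: "g i z0 z2 = z1"
        using ga[of z2] gb[of z2] d1 d2 three_colours[OF d0] by metis
      have fa: "fwd i b0 a1 + fwd i z0 a1 = 1" and fb: "fwd i a0 b1 + fwd i z0 b1 = 1"
        using sum_fwd'[of i a1] sum_fwd'[of i b1] sum_3[OF d0, of "\<lambda>s. fwd i s a1"] sum_3[OF d0, of "\<lambda>s. fwd i s b1"] f0
        by linarith+
      note c = card_3[OF d2]
      have gba: "g i b0 a2 = b1" "g i b0 z2 = b1" "g i a0 b2 = a1" "g i a0 z2 = a1" using ga gb d2 by auto
      have fa': "of_bool (g i b0 b2 = a1) + of_bool (g i z0 b2 = a1) = (1::nat)"
        using fa gba na gzz d1 unfolding c by (auto split: if_splits)
      have fb': "of_bool (g i a0 a2 = b1) + of_bool (g i z0 a2 = b1) = (1::nat)"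
        using fb gba nb gzz d1 unfolding c by (auto split: if_splits)
      have "fwd i z0 z1 \<le> 2" by (rule fwd_le)
      then have nz: "g i z0 a2 \<noteq> z1" "g i z0 b2 \<noteq> z1"
        using f0(3) gzz unfolding c by (auto split: if_splits)
      then have r: "g i z0 a2 = b1" "g i z0 b2 = a1"
        using three_colours[OF d1] na nb by metis+
      then have "g i a0 a2 \<noteq> b1" "g i b0 b2 \<noteq> a1" using fa' fb' by auto
      then have "g i a0 a2 = z1" "g i b0 b2 = z1"
        using three_colours[OF d1] na nb by metis+
      with r gzz show "g i (x i) (x (Suc (Suc i))) = z (Suc i)" "g i (x (i + n)) (x (Suc (Suc i) + n)) = z (Suc i)"
        "g i (z i) (x (Suc (Suc i))) = x (Suc i + n)" "g i (z i) (x (Suc (Suc i) + n)) = x (Suc i)"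
        "g i (z i) (z (Suc (Suc i))) = z (Suc i)" unfolding defs by auto
    qed
    note xz = xg[THEN iffD2, OF z(1)] yg[THEN iffD2, OF z(2)]
    have tabm: "g i (x (i + k * n)) (x (Suc (Suc i) + k * n)) = z (Suc i)"
      "g i (z i) (x (Suc (Suc i) + k * n)) = x (Suc i + Suc k * n)"
      "g i (x (i + k * n)) (z (Suc (Suc i))) = x (Suc i + k * n)" for i k
      using tab(1-4)[of i] xz[of i] unfolding parity[of _ k] parity[of _ "Suc k"] by auto
    have alt: "g j (x (j + k * n)) (x (Suc (Suc j) + Suc k * n)) \<noteq> z (Suc j)" for j k
    proof -
      have "x (Suc (Suc j) + Suc k * n) \<noteq> x (Suc (Suc j) + k * n)"
        using ne1[of "Suc (Suc j) + k * n"] by (simp add: ac_simps)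
      then have "g j (x (j + k * n)) (x (Suc (Suc j) + Suc k * n)) = x (Suc j + k * n)" using xgm by blast
      then show ?thesis using z[of "Suc j"] unfolding parity[of "Suc j" k] by metis
    qed
    have no_walk: False if "p n = p 0" "p (Suc n) = p 1"
      "\<And>j. g j (p j) (p (Suc (Suc j))) \<noteq> p (Suc j)" for p
      using no_closed_sequence[of p 0] that by auto
    show ?thesis
    proof (cases "odd n")
      case True
      \<comment> \<open>The colours alternate between the two rounds of \<open>x\<close>. Both
        neighbours are then in the same round, so the guess is the third colour. Closing up takes n
        + 1 switches, an even number.\<close>
      define p where "p j = x (j + j * n)" for j
      have per_p: "p (n + j) = p j" for j
      proof -
        have "p (n + j) = x (j + (j + (1 + n)) * n)" unfolding p_def by (simp add: algebra_simps)
        also have "\<dots> = x (j + j * n)" using True unfolding parity[of j "j + (1 + n)"] parity[of j j] by simp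
        finally show ?thesis by (simp add: p_def)
      qed
      have "g j (p j) (p (Suc (Suc j))) \<noteq> p (Suc j)" for j
      proof -
        have "p (Suc (Suc j)) = x (Suc (Suc j) + j * n)"
          unfolding p_def parity[of _ "Suc (Suc j)"] parity[of _ j] by simp
        then have "g j (p j) (p (Suc (Suc j))) = z (Suc j)" using tabm(1) by (simp add: p_def)
        then show ?thesis using z[of "Suc j"] unfolding p_def parity[of "Suc j" "Suc j"] by auto
      qed
      then show ?thesis using no_walk[of p] per_p[of 0] per_p[of 1] by auto
    next
      case even: False
      show ?thesis
      proof (cases "odd (n div 2)")
        case True
        \<comment> \<open>Third colours at odd positions, alternating rounds of \<open>x\<close> at
          even ones. Closing up takes 1 + n div 2 switches, which is even here.\<close>
        define p where "p j = (if odd j then z j else x (j + j div 2 * n))" for j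
        have pn: "p n = p 0" 
        proof -
          have "p n = x (0 + (1 + n div 2) * n)" using even unfolding p_def by simp
          then show ?thesis using True unfolding parity[of 0 "1 + n div 2"] by (simp add: p_def)
        qed
        moreover have "p (Suc n) = p 1" using even zper[of 1] by (simp add: p_def)
        moreover have "g j (p j) (p (Suc (Suc j))) \<noteq> p (Suc j)" for j
        proof (cases "odd j")
          case True
          then show ?thesis using tab(5)[of j] z[of "Suc j"] unfolding p_def parity[of "Suc j" "Suc j div 2"] by auto
        next
          case False
          have "p (Suc (Suc j)) = x (Suc (Suc j) + Suc (j div 2) * n)" using False by (simp add: p_def)
          moreover have "p (Suc j) = z (Suc j)" "p j = x (j + (j div 2) * n)" using False by (simp_all add: p_def)
          ultimately show ?thesis using alt by metis
        qed
        ultimately show ?thesis using no_walk[of p] by auto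
      next
        case False
        have n8: "n \<ge> 8" using even False n_ge by presburger
        \<comment> \<open>The initial block a, z, z, b, z, z puts a at position 6, where the
          previous pattern has b, and so corrects the parity. There is room for it since n is at
          least 8; for n = 4 there is none, and there the players do win with three colours.\<close>
        define p where "p j = (if j = 0 then x 0 else if j = 3 then x (3 + n) else if j < 6 \<or> odd j then z j
          else x (j + (j - 6) div 2 * n))" for j
        have "p n = p 0"
        proof -
          have "(n - 6) div 2 = n div 2 - 3" by simp
          then have "n + (n - 6) div 2 * n = 0 + (1 + (n div 2 - 3)) * n" by simp
          moreover have "even (1 + (n div 2 - 3))" using False n8 by auto
          ultimately have "x (n + (n - 6) div 2 * n) = x 0" using parity[of 0 "1 + (n div 2 - 3)"] by metis
          then show ?thesis using n8 even by (simp add: p_def)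
        qed
        moreover have "p (Suc n) = p 1" using even zper[of 1] n8 by (simp add: p_def)
        moreover have "g j (p j) (p (Suc (Suc j))) \<noteq> p (Suc j)" for j
        proof -
          have "j = 0 \<or> j = 1 \<or> j = 2 \<or> j = 3 \<or> j = 4 \<or> j \<ge> 5 \<and> odd j \<or> j \<ge> 6 \<and> even j" by presburger
          then consider "j = 0" | "j = 1" | "j = 2" | "j = 3" | "j = 4" | "j \<ge> 5" "odd j" | "j \<ge> 6" "even j"
            by blast
          then show ?thesis
          proof cases
            case 1 then show ?thesis using xz(1)[of 0] z[of 1] by (simp add: p_def numeral_2_eq_2)
          next
            case 2 then show ?thesis using tab(4)[of 1] z[of 2] by (simp add: p_def numeral_2_eq_2 numeral_3_eq_3)
          next
            case 3 then show ?thesis using tab(5)[of 2] z[of 3] by (simp add: p_def)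
          next
            case 4 then show ?thesis using xz(2)[of 3] z[of 4] by (simp add: p_def)
          next
            case 5 then show ?thesis using tab(3)[of 4] z[of 5] by (simp add: p_def)
          next
            case 6
            then show ?thesis using tab(5)[of j] z[of "Suc j"] parity[of "Suc j" "(Suc j - 6) div 2"] unfolding p_def by auto
          next
            case 7
            have "(Suc (Suc j) - 6) div 2 = Suc ((j - 6) div 2)" using 7 by auto
            then have "p (Suc (Suc j)) = x (Suc (Suc j) + Suc ((j - 6) div 2) * n)" using 7 by (simp add: p_def)
            moreover have "p (Suc j) = z (Suc j)" "p j = x (j + ((j - 6) div 2) * n)" using 7 by (auto simp: p_def)
            ultimately show ?thesis using alt by metis
          qed
        qed
        ultimately show ?thesis using no_walk[of p] by auto
      qed
    qed
  qed
qed


section \<open>Guesses that are Latin squares\<close>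

lemma card_fwd_1:
  assumes "\<And>i s t. fwd i s t \<noteq> 2"
  shows "fwd i s t = 1"
proof -
  have le: "fwd i s t \<le> 1" for t using assms[of i s t] fwd_le[of i s t] by linarith
  have "(\<Sum>t\<in>UNIV. fwd i s t) = (\<Sum>t\<in>(UNIV :: 3 set). 1)" by (simp add: sum_fwd)
  then show ?thesis using sum_mono_inv[of "fwd i s" UNIV "\<lambda>_. 1" t] le by simp
qed

text \<open>Without an entry 2 all counts are 1 and each guess is a Latin square. The set of pairs
  reachable from a fixed pair then grows: after four steps it contains all those whose first colour
  is not one exceptional colour \<open>e1\<close>, after five steps all pairs. As \<open>n\<close>
  is at least 5, the starting pair is among them.\<close>

lemma fwd2_exists: "\<exists>i s t. fwd i s t = 2"
proof (rule ccontr)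
  assume "\<not> ?thesis"
  then have 1: "fwd i s t = 1" for i s t using card_fwd_1 by blast
  then have "bwd i s t = 1" for i s t using fwd_bwd[of i s t] by simp
  then have left: "\<exists>!a. g i a c = b" for i b c
    by (rule card_1_ex1)
  have right: "\<exists>!c. g i a c = b" for i a b 
    by (rule card_1_ex1[OF 1])
  fix s t :: 3
  obtain c0 where c0: "g 0 s c0 = t" using right by blast
  have W2: "walk g 0 2 s t c d" if "c \<noteq> c0" "g 1 t d \<noteq> c" for c d
  proof -
    have "walk g 0 1 s t t c" unfolding walk_1 using right c0 that by metis
    then show ?thesis by (rule walk_snoc') (use that in auto)
  qed
  have W3: "walk g 0 3 s t d e" if "c \<noteq> c0" "g 1 t d \<noteq> c" "g 2 c e \<noteq> d" for c d e
    by (rule walk_snoc'[OF W2[OF that(1,2)] that(3)]) auto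
  \<comment> \<open>\<open>d0\<close> can follow both admissible colours \<open>c1\<close> and
    \<open>c2\<close>, \<open>d1\<close> can follow \<open>c2\<close>, and \<open>e1\<close> is the
    colour blocked after that. Any \<open>e\<close> other than \<open>e1\<close> can therefore
    follow both \<open>d0\<close> and \<open>d1\<close>, and at least one of these two admits any
    given next colour.\<close>
  obtain d0 where d0: "g 1 t d0 = c0" using right by blast
  obtain c1 where c1: "c1 \<noteq> c0" using third_colour by blast
  obtain c2 where c2: "c2 \<noteq> c0" "c2 \<noteq> c1" using third_colour by blast
  obtain d1 where d1: "g 1 t d1 = c1" using right by blast
  obtain e1 where e1: "g 2 c2 e1 = d1" using right by blast
  have "d0 \<noteq> d1" using d0 d1 c1 by auto
  have W4: "walk g 0 4 s t e f" if "e \<noteq> e1" for e f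
  proof -
    have "\<exists>d. (d = d0 \<or> d = d1) \<and> g 3 d f \<noteq> e" using left \<open>d0 \<noteq> d1\<close> by metis
    then obtain d where d: "d = d0 \<or> d = d1" "g 3 d f \<noteq> e" by blast
    have "walk g 0 3 s t d1 e"
      by (rule W3[of c2]) (use c2 d1 e1 right that in \<open>metis+\<close>)
    moreover have "walk g 0 3 s t d0 e"
    proof (cases "g 2 c1 e = d0")
      case True
      then have "g 2 c2 e \<noteq> d0" using left c2 by metis
      then show ?thesis using W3[of c2 d0 e] c2 d0 by auto
    next
      case False
      then show ?thesis using W3[of c1 d0 e] c1 d0 by auto
    qed
    ultimately have "walk g 0 3 s t d e" using d by blast
    then show ?thesis using d(2) by (rule walk_snoc') auto
  qed
  have full: "walk g 0 (5 + k) s t b c" for k b c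
  proof (induction k arbitrary: b c)
    case (0 b c)
    obtain e where "e \<noteq> e1" "g 4 e c \<noteq> b"
    proof -
      obtain e where "e \<noteq> e1" using third_colour by blast
      moreover obtain e' where "e' \<noteq> e1" "e' \<noteq> e" using third_colour by blast
      ultimately show ?thesis using that left by metis
    qed
    then have "walk g 0 5 s t b c" by (intro walk_snoc'[OF W4]) auto
    then show ?case by simp
  next
    case (Suc k b c)
    obtain a where "g (5 + k) a c \<noteq> b" using left neq_3(1) by metis
    then show ?case by (intro walk_snoc'[OF Suc]) auto
  qed
  show False using full[of "n - 5" s t] none n_ge by simp
qed

theorem three_dvd: "3 dvd n"
  using fwd2_exists fwd2_dvd by blast

end

section \<open>Losing games on cycles\<close>

definition all_wrong :: "nat \<Rightarrow> nat \<Rightarrow> (nat \<Rightarrow> nat \<Rightarrow> nat \<Rightarrow> nat) \<Rightarrow> (nat \<Rightarrow> nat) \<Rightarrow> bool" where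
  "all_wrong q n G y \<longleftrightarrow> (\<forall>i<n. y i < q \<and> y i \<noteq> G i (y ((i + n - 1) mod n)) (y (Suc i mod n)))"

definition cycle_loses :: "nat \<Rightarrow> nat \<Rightarrow> bool" where
  "cycle_loses q n \<longleftrightarrow> (\<forall>G. \<exists>y. all_wrong q n G y)"

text \<open>The strongly losing cycles of the overview, with the distinguished vertex at 0. For
  \<open>n = 2\<close> both neighbours of a vertex coincide and the cycle is a single edge, which
  lets bridges be handled like cycles.\<close>

definition cycle_loses_rooted :: "nat \<Rightarrow> nat \<Rightarrow> bool" where
  "cycle_loses_rooted q n \<longleftrightarrow>
     (\<forall>G. \<forall>x<q. \<forall>x'<q. x \<noteq> x' \<longrightarrow> (\<exists>y. all_wrong q n G y \<and> y 0 \<in> {x, x'}))"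

lemma cycle_loses_3:
  assumes n: "n \<ge> 5" and n3: "\<not> 3 dvd n"
  shows "cycle_loses 3 n"
  unfolding cycle_loses_def
proof
  fix G
  define num :: "3 \<Rightarrow> nat" where "num c = (if c = 0 then 0 else if c = 1 then 1 else 2)" for c
  have num3: "num c < 3" for c by (simp add: num_def)
  have of_num: "of_nat (num c) = c" for c using exhaust_three[of c] by (auto simp: num_def)
  \<comment> \<open>Values of \<open>G\<close> beyond 2 are reduced modulo 3, which can only make
    more guesses right.\<close>
  define g :: "nat \<Rightarrow> 3 \<Rightarrow> 3 \<Rightarrow> 3" where "g i a c = of_nat (G (Suc i mod n) (num a) (num c))" for i a c
  have "\<not> no_closed_walk g n" using no_closed_walk.three_dvd n3 by blast
  moreover have "g (i + n) = g i" for i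
    unfolding g_def by (metis add_Suc mod_add_self2)
  ultimately obtain i s t where "walk g i n s t s t" unfolding no_closed_walk_def using n by blast
  then obtain p where p: "p n = p 0" "p (Suc n) = p 1"
    "\<And>j. j < n \<Longrightarrow> g (i + j) (p j) (p (Suc (Suc j))) \<noteq> p (Suc j)" unfolding walk_def by metis
  define a where "a = i mod n"
  have a: "a < n" using n by (simp add: a_def)
  \<comment> \<open>The closed walk starts at \<open>i\<close> rather than 0, so \<open>y\<close>
    inverts the map sending \<open>k\<close> to \<open>(i + k) mod n\<close>; \<open>n\<close> is
    added before subtracting to prevent truncation.\<close>
  define y where "y v = num (p ((v + n - a) mod n))" for v
  have y: "y ((i + k) mod n) = num (p k)" if "k < n" for k
  proof -
    have "(i + k) mod n = (a + k) mod n" by (simp add: a_def mod_add_left_eq)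
    moreover have "((a + k) mod n + n - a) mod n = k"
      using a that by (cases "a + k < n") (auto simp: mod_if[of "a + k"])
    ultimately show ?thesis by (simp add: y_def)
  qed
  have y': "y ((i + k) mod n) = num (p k)" if "k \<le> Suc n" for k
  proof -
    have "k < n \<or> k = n \<or> k = Suc n" using that by auto
    then consider "k < n" | "k = n" | "k = Suc n" by blast
    then show ?thesis
    proof cases
      case 2
      then show ?thesis using y[of 0] n p by simp
    next
      case 3
      have "(i + Suc n) mod n = (i + 1) mod n" by (metis add_Suc_right add.right_neutral add_Suc mod_add_self2 One_nat_def)
      then show ?thesis using y[of 1] n p 3 by simp
    qed (rule y)
  qed
  have "all_wrong 3 n G y"
    unfolding all_wrong_def
  proof (intro allI impI)
    fix v assume v: "v < n"
    define b where "b = Suc i mod n"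
    have b: "b < n" using n by (simp add: b_def)
    define j where "j = (v + n - b) mod n"
    have j: "j < n" using n by (simp add: j_def)
    have jv: "(i + Suc j) mod n = v"
    proof -
      have "(i + Suc j) mod n = (b + j) mod n" by (simp add: b_def mod_add_left_eq)
      also have "\<dots> = v" unfolding j_def using b v by (cases "b \<le> v") (auto simp: mod_if[of "v + n - b"])
      finally show ?thesis .
    qed
    have "(v + n - 1) mod n = (i + j) mod n"
    proof -
      have "(v + n - 1) mod n = (v + (n - 1)) mod n" using n by simp
      also have "\<dots> = (i + Suc j + (n - 1)) mod n" using jv by (metis mod_add_left_eq)
      also have "i + Suc j + (n - 1) = i + j + n" using n by simp
      finally show ?thesis by simp
    qed
    moreover have "Suc v mod n = (i + Suc (Suc j)) mod n" using jv by (metis add_Suc_right mod_Suc_eq)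
    ultimately have e: "y v = num (p (Suc j))" "y ((v + n - 1) mod n) = num (p j)" "y (Suc v mod n) = num (p (Suc (Suc j)))"
      using y'[of "Suc j"] y'[of j] y'[of "Suc (Suc j)"] jv j by auto
    have "Suc (i + j) mod n = v" using jv by simp
    then have "of_nat (G v (num (p j)) (num (p (Suc (Suc j))))) \<noteq> p (Suc j)" using p(3)[OF j] by (simp add: g_def)
    then have "num (p (Suc j)) \<noteq> G v (num (p j)) (num (p (Suc (Suc j))))" using of_num by metis
    then show "y v < 3 \<and> y v \<noteq> G v (y ((v + n - 1) mod n)) (y (Suc v mod n))" using num3 e by simp
  qed
  then show "\<exists>y. all_wrong 3 n G y" by blast
qed

text \<open>Each of the three guesses is right on at most 16 of the 64 colourings.\<close>

lemma cycle_loses_4_3: "cycle_loses 4 3"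
  unfolding cycle_loses_def
proof
  fix G :: "nat \<Rightarrow> nat \<Rightarrow> nat \<Rightarrow> nat"
  let ?U = "{..<4::nat}"
  let ?f0 = "\<lambda>(b, c). (G 0 c b, b, c)" and ?f1 = "\<lambda>(a, c). (a, G 1 a c, c)" and ?f2 = "\<lambda>(a, b). (a, b, G 2 b a)"
  let ?B = "?f0 ` (?U \<times> ?U) \<union> ?f1 ` (?U \<times> ?U) \<union> ?f2 ` (?U \<times> ?U)"
  have "card (f ` (?U \<times> ?U)) \<le> 16" for f :: "nat \<times> nat \<Rightarrow> nat \<times> nat \<times> nat"
    using card_image_le[of "?U \<times> ?U" f] by simp
  note le16 = this
  have "card ?B \<le> card (?f0 ` (?U \<times> ?U) \<union> ?f1 ` (?U \<times> ?U)) + card (?f2 ` (?U \<times> ?U))"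
    by (rule card_Un_le)
  also have "card (?f0 ` (?U \<times> ?U) \<union> ?f1 ` (?U \<times> ?U)) \<le> card (?f0 ` (?U \<times> ?U)) + card (?f1 ` (?U \<times> ?U))"
    by (rule card_Un_le)
  also have "card (?f0 ` (?U \<times> ?U)) + card (?f1 ` (?U \<times> ?U)) + card (?f2 ` (?U \<times> ?U)) \<le> 16 + 16 + 16"
    by (intro add_mono le16)
  finally have "card ?B \<le> 48" by simp
  also have "48 < card (?U \<times> ?U \<times> ?U)" by simp
  finally have "\<not> ?U \<times> ?U \<times> ?U \<subseteq> ?B" using card_mono[of ?B "?U \<times> ?U \<times> ?U"] by (meson finite_Un finite_imageI finite_SigmaI finite_lessThan linorder_not_less)
  then obtain a b c where abc: "a < 4" "b < 4" "c < 4" "(a, b, c) \<notin> ?B" by auto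
  define y where "y i = (if i = 0 then a else if i = 1 then b else c)" for i :: nat
  have "a \<noteq> G 0 c b" using abc by force
  moreover have "b \<noteq> G 1 a c" using abc by force
  moreover have "c \<noteq> G 2 b a" using abc by force
  ultimately have "y i < 4 \<and> y i \<noteq> G i (y ((i + 3 - 1) mod 3)) (y (Suc i mod 3))"
    if "i = 0 \<or> i = 1 \<or> i = 2" for i
    using that abc(1-3) by (elim disjE) (simp_all add: y_def)
  moreover have "i = 0 \<or> i = 1 \<or> i = 2" if "i < 3" for i :: nat using that by auto
  ultimately have "all_wrong 4 3 G y" unfolding all_wrong_def by blast
  then show "\<exists>y. all_wrong 4 3 G y" by blast
qed

section \<open>Strongly losing cycles by counting neighbour colours\<close>

text \<open>The counterpart of \<open>walk\<close> for \<open>q\<close> colours, along the vertices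
  1 to \<open>k\<close> beside a root of colour \<open>x\<close>. Vertex \<open>k\<close> sees the
  colour \<open>e\<close>, but the guess of the vertex coloured \<open>e\<close> is not tested
  yet.\<close>

definition path_rel :: "(nat \<Rightarrow> nat \<Rightarrow> nat \<Rightarrow> nat) \<Rightarrow> nat \<Rightarrow> nat \<Rightarrow> nat \<Rightarrow> nat \<Rightarrow> nat \<Rightarrow> nat \<Rightarrow> bool" where
  "path_rel G q x k t b e \<longleftrightarrow> (\<exists>p. p 0 = x \<and> p 1 = t \<and> p k = b \<and> p (Suc k) = e \<and>
     (\<forall>j<k. p (Suc j) < q \<and> p (Suc j) \<noteq> G (Suc j) (p j) (p (Suc (Suc j)))))"

lemma path_rel_1: "t < q \<Longrightarrow> t \<noteq> G 1 x e \<Longrightarrow> path_rel G q x 1 t t e"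
  unfolding path_rel_def
  by (intro exI[of _ "\<lambda>j. if j = 0 then x else if j = 1 then t else e"]) auto

lemma path_rel_snoc:
  assumes "path_rel G q x k t b c" "c < q" "c \<noteq> G (Suc k) b d"
  shows "path_rel G q x (Suc k) t c d"
proof -
  obtain p where p: "p 0 = x" "p 1 = t" "p k = b" "p (Suc k) = c"
     "\<forall>j<k. p (Suc j) < q \<and> p (Suc j) \<noteq> G (Suc j) (p j) (p (Suc (Suc j)))"
    using assms(1) unfolding path_rel_def by blast
  show ?thesis unfolding path_rel_def
    by (rule exI[of _ "p(Suc (Suc k) := d)"]) (use p assms(2,3) in \<open>auto simp: less_Suc_eq\<close>)
qed

lemma path_rel_less: "path_rel G q x (Suc k) t b e \<Longrightarrow> b < q"
  unfolding path_rel_def by auto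

lemma path_rel_2:
  assumes "t < q" "b < q" "t \<noteq> G 1 x b" "b \<noteq> G 2 t e"
  shows "path_rel G q x 2 t b e"
  using path_rel_snoc[OF path_rel_1, of t q G x b e] assms by (simp add: numeral_2_eq_2)

text \<open>The guess of vertex 0 depends only on the colours \<open>t\<close> and \<open>e\<close>
  of its two neighbours. If these can be kept the same for both root colours, that single guess
  misses one of them.\<close>

lemma cycle_loses_rootedI:
  assumes n: "n \<ge> 2"
    and ex: "\<And>G x x'. x < q \<Longrightarrow> x' < q \<Longrightarrow> x \<noteq> x' \<Longrightarrow>
      \<exists>t e. path_rel G q x (n - 1) t e x \<and> path_rel G q x' (n - 1) t e x'"
  shows "cycle_loses_rooted q n"
  unfolding cycle_loses_rooted_def
proof (intro allI impI)
  fix G and x x' :: nat assume x: "x < q" "x' < q" "x \<noteq> x'"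
  obtain t e where te: "path_rel G q x (n - 1) t e x" "path_rel G q x' (n - 1) t e x'"
    using ex[OF x] by blast
  obtain w where w: "w \<in> {x, x'}" "w \<noteq> G 0 e t" using x(3) by auto
  have "path_rel G q w (n - 1) t e w" using te w by auto
  then obtain p where p: "p 0 = w" "p 1 = t" "p (n - 1) = e" "p n = w"
    "\<forall>j<n - 1. p (Suc j) < q \<and> p (Suc j) \<noteq> G (Suc j) (p j) (p (Suc (Suc j)))"
    unfolding path_rel_def using n by auto
  have "all_wrong q n G p" unfolding all_wrong_def
  proof (intro allI impI)
    fix i assume i: "i < n"
    show "p i < q \<and> p i \<noteq> G i (p ((i + n - 1) mod n)) (p (Suc i mod n))"
    proof (cases i)
      case 0
      then show ?thesis using p(1-3) w x n by auto
    next
      case (Suc j)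
      have "(i + n - 1) mod n = j" using Suc i n by simp
      moreover have "p (Suc i mod n) = p (Suc i)"
        using i p(1,4) by (cases "Suc i = n") auto
      ultimately show ?thesis using p(5) Suc i by auto
    qed
  qed
  then show "\<exists>y. all_wrong q n G y \<and> y 0 \<in> {x, x'}" using p w by blast
qed

lemma cycle_loses_rooted_2:
  assumes "q \<ge> 3"
  shows "cycle_loses_rooted q 2"
proof (rule cycle_loses_rootedI)
  fix G :: "nat \<Rightarrow> nat \<Rightarrow> nat \<Rightarrow> nat" and x x' :: nat
  have "card {G 1 x x, G 1 x' x'} < card {..<q}"
    using assms by (simp add: card_insert_if)
  then have "\<not> {..<q} \<subseteq> {G 1 x x, G 1 x' x'}"
    using card_mono[of "{G 1 x x, G 1 x' x'}" "{..<q}"] by auto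
  then obtain t where "t < q" "t \<noteq> G 1 x x" "t \<noteq> G 1 x' x'" by auto
  then show "\<exists>t e. path_rel G q x (2 - 1) t e x \<and> path_rel G q x' (2 - 1) t e x'"
    using path_rel_1[of t q G] by auto
qed auto

text \<open>For each root colour, either guess spoils one pair \<open>(t, e)\<close> per value of
  one coordinate, 2q pairs in all; 4q < q * q is where 5 colours enter.\<close>

lemma cycle_loses_rooted_3:
  assumes "q \<ge> 5"
  shows "cycle_loses_rooted q 3"
proof (rule cycle_loses_rootedI)
  fix G :: "nat \<Rightarrow> nat \<Rightarrow> nat \<Rightarrow> nat" and x x' :: nat
  define B where "B y = (\<lambda>e. (G 1 y e, e)) ` {..<q} \<union> (\<lambda>t. (t, G 2 t y)) ` {..<q}" for y
  have fin: "finite (B y)" for y by (simp add: B_def)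
  have card: "card (B y) \<le> 2 * q" for y
  proof -
    have le: "card (f ` {..<q}) \<le> q" for f :: "nat \<Rightarrow> nat \<times> nat" using card_image_le[of "{..<q}" f] by simp
    have "card (B y) \<le> q + q" unfolding B_def by (rule order.trans[OF card_Un_le]) (intro add_mono le)
    then show ?thesis by simp
  qed
  have "card (B x \<union> B x') \<le> 4 * q"
    using card_Un_le[of "B x" "B x'"] card[of x] card[of x'] by simp
  also have "\<dots> < q * q" using assms by simp
  finally have "card (B x \<union> B x') < card ({..<q} \<times> {..<q})" by simp
  then have "\<not> {..<q} \<times> {..<q} \<subseteq> B x \<union> B x'" using card_mono[of "B x \<union> B x'"] fin
    by (meson finite_Un linorder_not_less)
  then obtain t e where te: "t < q" "e < q" "(t, e) \<notin> B x" "(t, e) \<notin> B x'" by auto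
  have "path_rel G q y 2 t e y" if "(t, e) \<notin> B y" for y
    using that te(1,2) unfolding B_def by (intro path_rel_2) auto
  then show "\<exists>t e. path_rel G q x (3 - 1) t e x \<and> path_rel G q x' (3 - 1) t e x'"
    using te by auto
qed auto

text \<open>The first colours whose walks cannot leave \<Psi> at vertex \<open>k\<close>. With
  \<Psi> the colours for which the next guess is \<open>e\<close>, these are the first colours that
  cannot be continued beyond \<open>e\<close>.\<close>

definition confined :: "(nat \<Rightarrow> nat \<Rightarrow> nat \<Rightarrow> nat) \<Rightarrow> nat \<Rightarrow> nat \<Rightarrow> nat \<Rightarrow> nat \<Rightarrow> nat set \<Rightarrow> nat set" where
  "confined G q x k e \<Psi> = {t. t < q \<and> (\<forall>b. path_rel G q x k t b e \<longrightarrow> b \<in> \<Psi>)}"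

lemma finite_confined [simp]: "finite (confined G q x k e \<Psi>)"
  by (rule finite_subset[of _ "{..<q}"]) (auto simp: confined_def)

lemma card_confined_le_q: "card (confined G q x k e \<Psi>) \<le> q"
  using card_mono[of "{..<q}" "confined G q x k e \<Psi>"] by (auto simp: confined_def)

lemma sum_card_fibres:
  fixes f :: "nat \<Rightarrow> nat"
  assumes "finite A"
  shows "(\<Sum>c\<in>A. card {b. b < q \<and> f b = c}) \<le> q"
proof -
  have "(\<Sum>c\<in>A. card {b. b < q \<and> f b = c}) = card (\<Union>c\<in>A. {b. b < q \<and> f b = c})"
    by (rule card_UN_disjoint[symmetric]) (use assms in auto)
  also have "\<dots> \<le> card {..<q}" by (rule card_mono) auto
  finally show ?thesis by simp
qed

lemma small_fibre:
  fixes f :: "nat \<Rightarrow> nat"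
  assumes "finite A" "card A * Suc m > q"
  shows "\<exists>c\<in>A. card {b. b < q \<and> f b = c} \<le> m"
proof (rule ccontr)
  assume "\<not> ?thesis"
  then have "(\<Sum>c\<in>A. Suc m) \<le> (\<Sum>c\<in>A. card {b. b < q \<and> f b = c})"
    by (intro sum_mono) auto
  then show False using sum_card_fibres[OF assms(1), of q f] assms(2) by simp
qed

text \<open>For each colour \<open>c\<close> outside \<Psi>, a first colour confined one step later
  is already confined to the fibre of \<open>c\<close> under the next guess. These fibres are
  disjoint, so among at least 3 (or 2) colours outside \<Psi> one has a fibre of size at most q - 3
  (or q - 2), because 3(q - 2) and 2(q - 1) exceed q. The thresholds thus reproduce themselves, and
  the bounds hold for any length.\<close>

lemma confined_bound:
  assumes q: "q \<ge> 4" and k: "k \<ge> 2"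
  shows "card \<Psi> \<le> q - 3 \<Longrightarrow> \<Psi> \<subseteq> {..<q} \<Longrightarrow> card (confined G q x k e \<Psi>) \<le> 1"
    and "card \<Psi> \<le> q - 2 \<Longrightarrow> \<Psi> \<subseteq> {..<q} \<Longrightarrow> card (confined G q x k e \<Psi>) \<le> 2"
proof -
  have co: "card ({..<q} - \<Psi>) \<ge> m" if "card \<Psi> \<le> q - m" "\<Psi> \<subseteq> {..<q}" "m \<le> q" for \<Psi> m
    using that card_Diff_subset[of \<Psi> "{..<q}"] finite_subset[OF that(2)] by auto
  have "(card \<Psi> \<le> q - 3 \<longrightarrow> \<Psi> \<subseteq> {..<q} \<longrightarrow> card (confined G q x k e \<Psi>) \<le> 1) \<and>
      (card \<Psi> \<le> q - 2 \<longrightarrow> \<Psi> \<subseteq> {..<q} \<longrightarrow> card (confined G q x k e \<Psi>) \<le> 2)"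
    using k
  proof (induction k arbitrary: e \<Psi> rule: nat_induct_at_least)
    case base
    define A where "A = {..<q} - \<Psi>"
    have mem: "G 1 x b = t" if "t \<in> confined G q x 2 e \<Psi>" "b \<in> A" "b \<noteq> G 2 t e" for t b
      using that path_rel_2[of t q b G x e] unfolding confined_def A_def by auto
    have "t = t'" if c: "card \<Psi> \<le> q - 3" "\<Psi> \<subseteq> {..<q}" and t: "t \<in> confined G q x 2 e \<Psi>" "t' \<in> confined G q x 2 e \<Psi>" for t t'
    proof -
      have "card {G 2 t e, G 2 t' e} < card A" using co[OF c] q unfolding A_def by (simp add: card_insert_if)
      then have "\<not> A \<subseteq> {G 2 t e, G 2 t' e}" using card_mono[of "{G 2 t e, G 2 t' e}" A] by auto
      then obtain b where "b \<in> A" "b \<noteq> G 2 t e" "b \<noteq> G 2 t' e" by auto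
      then show ?thesis using mem t by blast
    qed
    moreover have "card (confined G q x 2 e \<Psi>) \<le> 2" if c: "card \<Psi> \<le> q - 2" "\<Psi> \<subseteq> {..<q}"
    proof -
      have "card A \<ge> 2" using co[OF c] q unfolding A_def by simp
      then obtain a b where ab: "a \<in> A" "b \<in> A" "a \<noteq> b"
        by (meson card_2_iff' obtain_subset_with_card_n subsetD)
      have "confined G q x 2 e \<Psi> \<subseteq> {G 1 x a, G 1 x b}"
      proof
        fix t assume t: "t \<in> confined G q x 2 e \<Psi>"
        have "a \<noteq> G 2 t e \<or> b \<noteq> G 2 t e" using ab by auto
        then show "t \<in> {G 1 x a, G 1 x b}" using mem[OF t] ab by auto
      qed
      then have "card (confined G q x 2 e \<Psi>) \<le> card {G 1 x a, G 1 x b}" by (intro card_mono) auto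
      also have "\<dots> \<le> 2" by (simp add: card_insert_if)
      finally show ?thesis .
    qed
    ultimately show ?case by (auto simp: card_le_Suc0_iff_eq)
  next
    case (Suc k)
    define F where "F c = {b. b < q \<and> G (Suc k) b e = c}" for c
    define A where "A = {..<q} - \<Psi>"
    have sub: "confined G q x (Suc k) e \<Psi> \<subseteq> confined G q x k c (F c)" if "c \<in> A" for c
    proof
      fix t assume t: "t \<in> confined G q x (Suc k) e \<Psi>"
      have "b \<in> F c" if "path_rel G q x k t b c" for b
      proof -
        have "b < q" using that path_rel_less[of G q x "k - 1"] \<open>2 \<le> k\<close> by (cases k) auto
        moreover have "G (Suc k) b e = c"
          using t path_rel_snoc[OF that, of e] \<open>c \<in> A\<close> unfolding confined_def A_def by auto
        ultimately show ?thesis by (simp add: F_def)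
      qed
      then show "t \<in> confined G q x k c (F c)" using t by (auto simp: confined_def)
    qed
    have F: "F c \<subseteq> {..<q}" for c by (auto simp: F_def)
    have "card (confined G q x (Suc k) e \<Psi>) \<le> 1" if c: "card \<Psi> \<le> q - 3" "\<Psi> \<subseteq> {..<q}"
    proof -
      have "card A \<ge> 3" using co[OF c] q unfolding A_def by simp
      then have "3 * (q - 2) \<le> card A * Suc (q - 3)" using q by (intro mult_mono) auto
      then have "card A * Suc (q - 3) > q" using q by linarith
      from small_fibre[OF _ this, of "\<lambda>b. G (Suc k) b e"] obtain c where "c \<in> A" "card (F c) \<le> q - 3"
        unfolding F_def A_def by auto
      then show ?thesis using Suc.IH[of "F c" c] F sub[of c] card_mono[OF finite_confined] le_trans by metis
    qed
    moreover have "card (confined G q x (Suc k) e \<Psi>) \<le> 2" if c: "card \<Psi> \<le> q - 2" "\<Psi> \<subseteq> {..<q}"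
    proof -
      have "card A \<ge> 2" using co[OF c] q unfolding A_def by simp
      then have "2 * (q - 1) \<le> card A * Suc (q - 2)" using q by (intro mult_mono) auto
      then have "card A * Suc (q - 2) > q" using q by linarith
      from small_fibre[OF _ this, of "\<lambda>b. G (Suc k) b e"] obtain c where "c \<in> A" "card (F c) \<le> q - 2"
        unfolding F_def A_def by auto
      then show ?thesis using Suc.IH[of "F c" c] F sub[of c] card_mono[OF finite_confined] le_trans by metis
    qed
    ultimately show ?case by blast
  qed
  then show "card \<Psi> \<le> q - 3 \<Longrightarrow> \<Psi> \<subseteq> {..<q} \<Longrightarrow> card (confined G q x k e \<Psi>) \<le> 1"
    "card \<Psi> \<le> q - 2 \<Longrightarrow> \<Psi> \<subseteq> {..<q} \<Longrightarrow> card (confined G q x k e \<Psi>) \<le> 2" by auto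
qed

text \<open>A fibre with at least q - 1 colours leaves at most one colour to any other, so the sum
  is at most q + (q - 1). Otherwise each term is at most 2, and some fibre is small enough for its
  term to be at most 1.\<close>

lemma sum_confined_le:
  assumes q: "q \<ge> 4" and k: "k \<ge> 2"
  shows "(\<Sum>e<q. card (confined G q x k e {b. b < q \<and> f b = e})) \<le> 2 * q - 1"
proof -
  define F where "F e = {b. b < q \<and> f b = e}" for e
  have F: "F e \<subseteq> {..<q}" for e by (auto simp: F_def)
  define \<beta> where "\<beta> e = card (confined G q x k e (F e))" for e
  have b1: "\<beta> e \<le> 1" if "card (F e) \<le> q - 3" for e
    unfolding \<beta>_def by (rule confined_bound(1)[OF q k that F])
  have b2: "\<beta> e \<le> 2" if "card (F e) \<le> q - 2" for e
    unfolding \<beta>_def by (rule confined_bound(2)[OF q k that F])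
  have "(\<Sum>e<q. \<beta> e) \<le> 2 * q - 1"
  proof (cases "\<exists>e0<q. card (F e0) \<ge> q - 1")
    case True
    then obtain e0 where e0: "e0 < q" "card (F e0) \<ge> q - 1" by blast
    have le: "card (F e) \<le> q - 3" if "e < q" "e \<noteq> e0" for e
      using sum_card_fibres[of "{e0, e}" q f] that e0(2) q unfolding F_def by simp
    have "(\<Sum>e\<in>{..<q} - {e0}. \<beta> e) \<le> (\<Sum>e\<in>{..<q} - {e0}. 1)" by (rule sum_mono) (use b1 le in auto)
    moreover have "\<beta> e0 \<le> q" unfolding \<beta>_def by (rule card_confined_le_q)
    ultimately show ?thesis using sum.remove[of "{..<q}" e0 \<beta>] e0(1) by simp
  next
    case False
    have "4 * Suc (q - 3) \<le> q * Suc (q - 3)" using q by (intro mult_mono) auto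
    then have "card {..<q} * Suc (q - 3) > q" using q by simp
    from small_fibre[OF _ this, of f] obtain e1 where e1: "e1 < q" "card (F e1) \<le> q - 3" unfolding F_def by auto
    have "(\<Sum>e\<in>{..<q} - {e1}. \<beta> e) \<le> (\<Sum>e\<in>{..<q} - {e1}. 2)" by (rule sum_mono) (use b2 False in force)
    then show ?thesis using sum.remove[of "{..<q}" e1 \<beta>] e1 b1[of e1] by simp
  qed
  then show ?thesis by (simp add: \<beta>_def F_def)
qed

text \<open>The unit saved compared with a triangle makes 4 colours enough: two root colours spoil
  at most 4q - 2 pairs, fewer than q * q.\<close>

lemma cycle_loses_rooted_ge_4:
  assumes q: "q \<ge> 4" and n: "n \<ge> 4"
  shows "cycle_loses_rooted q n"
proof (rule cycle_loses_rootedI)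
  fix G :: "nat \<Rightarrow> nat \<Rightarrow> nat \<Rightarrow> nat" and x x' :: nat
  define k where "k = n - 2"
  have k: "k \<ge> 2" "n - 1 = Suc k" using n by (auto simp: k_def)
  define C where "C y e = confined G q y k e {b. b < q \<and> G (Suc k) b y = e}" for y e
  define B where "B y = (SIGMA e:{..<q}. C y e)" for y
  have fin: "finite (B y)" for y unfolding B_def C_def by simp
  have card: "card (B y) \<le> 2 * q - 1" for y
    using sum_confined_le[OF q k(1), of G y "\<lambda>b. G (Suc k) b y"]
    unfolding B_def C_def by (simp add: card_SigmaI)
  have "4 * q \<le> q * q" using q by simp
  then have "card (B x \<union> B x') < q * q"
    using card_Un_le[of "B x" "B x'"] card[of x] card[of x'] q by linarith
  then have "card (B x \<union> B x') < card ({..<q} \<times> {..<q})" by simp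
  then have "\<not> {..<q} \<times> {..<q} \<subseteq> B x \<union> B x'" using card_mono[of "B x \<union> B x'"] fin
    by (meson finite_Un linorder_not_less)
  then obtain t e where te: "t < q" "e < q" "(e, t) \<notin> B x" "(e, t) \<notin> B x'" by auto
  have "path_rel G q y (Suc k) t e y" if "(e, t) \<notin> B y" for y
  proof -
    have "t \<notin> C y e" using that te by (auto simp: B_def)
    then obtain b where b: "path_rel G q y k t b e" "b \<notin> {b. b < q \<and> G (Suc k) b y = e}"
      using te unfolding C_def confined_def by auto
    have "b < q" using b(1) path_rel_less[of G q y "k - 1"] k by (cases k) auto
    then show ?thesis using path_rel_snoc[OF b(1) te(2)] b(2) by auto
  qed
  then show "\<exists>t e. path_rel G q x (n - 1) t e x \<and> path_rel G q x' (n - 1) t e x'"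
    using te k by auto
qed (use n in auto)

section \<open>Reduction of a cactus to a cycle\<close>

definition sees_neighbors :: "'a set \<Rightarrow> 'a set set \<Rightarrow> ('a \<Rightarrow> ('a \<Rightarrow> nat) \<Rightarrow> nat) \<Rightarrow> bool" where
  "sees_neighbors V E f \<longleftrightarrow>
     (\<forall>v\<in>V. \<forall>c c'. (\<forall>u\<in>neighbors E v. c u = c' u) \<longrightarrow> f v c = f v c')"

text \<open>A form of the game that is easier to restrict and to glue: colourings are total, colours
  start at 0, and guesses may be out of range. \<open>winning_iff_wins\<close> ties it to the
  original.\<close>

definition wins :: "'a set \<Rightarrow> 'a set set \<Rightarrow> ('a \<Rightarrow> nat) \<Rightarrow> bool" where
  "wins V E h \<longleftrightarrow> (\<exists>f. sees_neighbors V E f \<and>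
     (\<forall>c. (\<forall>v\<in>V. c v < h v) \<longrightarrow> (\<exists>v\<in>V. f v c = c v)))"

lemma neighbors_subset: "simple_graph V E \<Longrightarrow> neighbors E v \<subseteq> V"
  unfolding simple_graph_def neighbors_def by blast

lemma winning_iff_wins:
  assumes G: "simple_graph V E" and h: "\<And>v. v \<in> V \<Longrightarrow> h v \<ge> 1"
  shows "winning V E h \<longleftrightarrow> wins V E h"
proof
  assume "winning V E h"
  then obtain f where f: "\<And>c. c \<in> colorings V h \<Longrightarrow> \<exists>v\<in>V. f v (restrict c (neighbors E v)) = c v"
    unfolding winning_def by blast
  define f' where "f' v c = f v (restrict (\<lambda>u. Suc (c u)) (neighbors E v)) - 1" for v c
  have "f' v c = f' v c'" if "\<forall>u\<in>neighbors E v. c u = c' u" for v c c'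
  proof -
    have "restrict (\<lambda>u. Suc (c u)) (neighbors E v) = restrict (\<lambda>u. Suc (c' u)) (neighbors E v)"
      using that by (auto simp: restrict_def)
    then show ?thesis by (simp add: f'_def)
  qed
  then have "sees_neighbors V E f'" unfolding sees_neighbors_def by blast
  moreover have "\<exists>v\<in>V. f' v c = c v" if c: "\<forall>v\<in>V. c v < h v" for c
  proof -
    have "restrict (\<lambda>u. Suc (c u)) V \<in> colorings V h" using c by (auto simp: colorings_def)
    then obtain v where v: "v \<in> V" "f v (restrict (restrict (\<lambda>u. Suc (c u)) V) (neighbors E v)) = Suc (c v)"
      using f by fastforce
    moreover have "restrict (restrict (\<lambda>u. Suc (c u)) V) (neighbors E v) = restrict (\<lambda>u. Suc (c u)) (neighbors E v)"
      using neighbors_subset[OF G, of v] by (auto simp: restrict_def fun_eq_iff)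
    ultimately show ?thesis unfolding f'_def by (metis diff_Suc_1)
  qed
  ultimately show "wins V E h" unfolding wins_def by blast
next
  assume "wins V E h"
  then obtain f where f: "sees_neighbors V E f" "\<And>c. \<forall>v\<in>V. c v < h v \<Longrightarrow> \<exists>v\<in>V. f v c = c v"
    unfolding wins_def by blast
  \<comment> \<open>An out-of-range guess is never right, so the legal value 1 may replace
    it.\<close>
  define f' where "f' v d = (let g = f v (\<lambda>u. d u - 1) in if g < h v then Suc g else 1)" for v and d :: "'a \<Rightarrow> nat"
  have "f' \<in> strategies V E h" unfolding strategies_def f'_def Let_def using h by auto
  moreover have "\<exists>v\<in>V. f' v (restrict c (neighbors E v)) = c v" if "c \<in> colorings V h" for c
  proof -
    have c: "1 \<le> c v" "c v \<le> h v" if "v \<in> V" for v using \<open>c \<in> _\<close> that by (auto simp: colorings_def)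
    have "\<forall>v\<in>V. c v - 1 < h v" using c h by fastforce
    then obtain v where v: "v \<in> V" "f v (\<lambda>u. c u - 1) = c v - 1"
      using f(2)[of "\<lambda>u. c u - 1"] by blast
    have "f v (\<lambda>u. restrict c (neighbors E v) u - 1) = f v (\<lambda>u. c u - 1)"
      using f(1) v(1) unfolding sees_neighbors_def by auto
    then have "f' v (restrict c (neighbors E v)) = c v" using v c[OF v(1)] unfolding f'_def Let_def by auto
    then show ?thesis using v(1) by blast
  qed
  ultimately show "winning V E h" unfolding winning_def by blast
qed

section \<open>Cycles and bridges as separators\<close>

abbreviation adj :: "'a set set \<Rightarrow> ('a \<times> 'a) set" where
  "adj E \<equiv> {(x, y). {x, y} \<in> E}"

lemma adj_mono: "F \<subseteq> E \<Longrightarrow> (adj F)\<^sup>* \<subseteq> (adj E)\<^sup>*"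
  by (rule rtrancl_mono) blast

lemma adj_sym: "(a, b) \<in> (adj E)\<^sup>* \<Longrightarrow> (b, a) \<in> (adj E)\<^sup>*"
  by (rule symD[OF sym_rtrancl]) (auto simp: sym_def insert_commute)

lemma simple_path_exists:
  assumes "(a, b) \<in> r\<^sup>*"
  shows "\<exists>xs. xs \<noteq> [] \<and> hd xs = a \<and> last xs = b \<and> distinct xs \<and>
    (\<forall>i. Suc i < length xs \<longrightarrow> (xs ! i, xs ! Suc i) \<in> r)"
  using assms
proof (induction rule: rtrancl_induct)
  case base
  then show ?case by (intro exI[of _ "[a]"]) auto
next
  case (step y z)
  then obtain xs where xs: "xs \<noteq> []" "hd xs = a" "last xs = y" "distinct xs"
    "\<And>i. Suc i < length xs \<Longrightarrow> (xs ! i, xs ! Suc i) \<in> r" by blast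
  show ?case
  proof (cases "z \<in> set xs")
    case True
    then obtain k where k: "k < length xs" "xs ! k = z" by (meson in_set_conv_nth)
    show ?thesis
    proof (intro exI[of _ "take (Suc k) xs"] conjI allI impI)
      show "last (take (Suc k) xs) = z" using k by (simp add: take_Suc_conv_app_nth)
      show "hd (take (Suc k) xs) = a" using xs(1,2) by (cases xs) auto
    qed (use xs k in \<open>auto\<close>)
  next
    case False
    show ?thesis
    proof (intro exI[of _ "xs @ [z]"] conjI allI impI)
      fix i assume i: "Suc i < length (xs @ [z])"
      show "((xs @ [z]) ! i, (xs @ [z]) ! Suc i) \<in> r"
      proof (cases "Suc i < length xs")
        case True
        then show ?thesis using xs(5) by (simp add: nth_append)
      next
        case False
        then have "Suc i = length xs" using i by simp
        moreover have "xs ! i = y" using calculation xs(1,3) by (metis diff_Suc_1 last_conv_nth)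
        ultimately show ?thesis using step.hyps(2) by (simp add: nth_append)
      qed
    qed (use xs False in auto)
  qed
qed

text \<open>A simple path from \<open>a\<close> to \<open>b\<close> avoiding the edge is closed by
  the edge. It has at least three vertices, since a path on two would be the edge itself.\<close>

lemma cycle_through_edge:
  assumes "{a, b} \<in> E" "a \<noteq> b" "(a, b) \<in> (adj (E - {{a, b}}))\<^sup>*"
  shows "\<exists>xs. distinct xs \<and> length xs \<ge> 3 \<and> xs ! 0 = a \<and> closed_walk_edges xs \<subseteq> E \<and> {a, b} \<in> closed_walk_edges xs"
proof -
  obtain xs where xs: "xs \<noteq> []" "hd xs = a" "last xs = b" "distinct xs"
    "\<And>i. Suc i < length xs \<Longrightarrow> (xs ! i, xs ! Suc i) \<in> adj (E - {{a, b}})"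
    using simple_path_exists[OF assms(3)] by blast
  have x0: "xs ! 0 = a" and xl: "xs ! (length xs - 1) = b" using xs(1-3) by (auto simp: hd_conv_nth last_conv_nth)
  have "length xs \<noteq> 0" "length xs \<noteq> 1" using xs(1) x0 xl assms(2) by auto
  moreover have "length xs \<noteq> 2" using xs(5)[of 0] x0 xl by auto
  ultimately have len: "length xs \<ge> 3" by linarith
  have last: "{b, a} = {xs ! (length xs - 1), xs ! (Suc (length xs - 1) mod length xs)}"
    using x0 xl xs(1) by simp
  have "closed_walk_edges xs \<subseteq> E"
  proof
    fix e assume "e \<in> closed_walk_edges xs"
    then obtain i where i: "i < length xs" "e = {xs ! i, xs ! (Suc i mod length xs)}"
      by (auto simp: closed_walk_edges_def)
    show "e \<in> E"
    proof (cases "Suc i < length xs")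
      case True
      then show ?thesis using xs(5)[OF True] i by auto
    next
      case False
      then have "i = length xs - 1" using i by simp
      then have "e = {b, a}" using i last by simp
      then show ?thesis using assms(1) by (simp add: insert_commute)
    qed
  qed
  moreover have "{a, b} \<in> closed_walk_edges xs"
    unfolding closed_walk_edges_def using last xs(1)
    by (intro CollectI exI[of _ "length xs - 1"]) (auto simp: insert_commute)
  ultimately show ?thesis using xs(4) len x0 by blast
qed

lemma Union_closed_walk_edges: "xs \<noteq> [] \<Longrightarrow> \<Union> (closed_walk_edges xs) = set xs"
proof
  assume xs: "xs \<noteq> []"
  show "\<Union> (closed_walk_edges xs) \<subseteq> set xs"
    using xs by (auto simp: closed_walk_edges_def)
  show "set xs \<subseteq> \<Union> (closed_walk_edges xs)"
  proof
    fix x assume "x \<in> set xs"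
    then obtain i where "i < length xs" "x = xs ! i" by (metis in_set_conv_nth)
    then have "{xs ! i, xs ! (Suc i mod length xs)} \<in> closed_walk_edges xs" "x \<in> {xs ! i, xs ! (Suc i mod length xs)}"
      by (auto simp: closed_walk_edges_def)
    then show "x \<in> \<Union> (closed_walk_edges xs)" by blast
  qed
qed

lemma prev_next_mod:
  fixes i n :: nat
  assumes "i < n"
  shows "Suc ((i + n - 1) mod n) mod n = i" "(Suc i mod n + n - 1) mod n = i"
proof -
  show "Suc ((i + n - 1) mod n) mod n = i"
    using assms by (cases i) (simp_all add: mod_Suc_eq)
  show "(Suc i mod n + n - 1) mod n = i"
    using assms by (cases "Suc i = n") auto
qed

lemma neighbors_closed_walk:
  assumes "distinct xs" "i < length xs"
  shows "neighbors (closed_walk_edges xs) (xs ! i) =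
    {xs ! ((i + length xs - 1) mod length xs), xs ! (Suc i mod length xs)}"
proof -
  let ?n = "length xs"
  have n: "?n > 0" using assms by auto
  have "u = xs ! ((i + ?n - 1) mod ?n) \<or> u = xs ! (Suc i mod ?n)" if "{u, xs ! i} = {xs ! j, xs ! (Suc j mod ?n)}" "j < ?n" for u j
  proof -
    have "(u = xs ! j \<and> xs ! i = xs ! (Suc j mod ?n)) \<or> (u = xs ! (Suc j mod ?n) \<and> xs ! i = xs ! j)"
      using that(1) by (auto simp: doubleton_eq_iff)
    then have "(u = xs ! j \<and> i = Suc j mod ?n) \<or> (u = xs ! (Suc j mod ?n) \<and> i = j)"
      using assms that(2) n by (metis distinct_conv_nth mod_less_divisor)
    then show ?thesis using prev_next_mod(2)[OF that(2)] by auto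
  qed
  moreover have "{xs ! ((i + ?n - 1) mod ?n), xs ! i} \<in> closed_walk_edges xs"
    unfolding closed_walk_edges_def using prev_next_mod(1)[OF assms(2)] n
    by (intro CollectI exI[of _ "(i + ?n - 1) mod ?n"]) simp
  moreover have "{xs ! (Suc i mod ?n), xs ! i} \<in> closed_walk_edges xs"
    unfolding closed_walk_edges_def using assms(2)
    by (intro CollectI exI[of _ i]) (simp add: insert_commute)
  ultimately show ?thesis
    unfolding neighbors_def by (auto simp: closed_walk_edges_def)
qed

text \<open>Equal edges at different indices have their ends swapped, so each index is the successor
  of the other modulo the length, which is impossible from length 3 on.\<close>

lemma closed_walk_edge_inj:
  assumes "distinct xs" "length xs \<ge> 3" "i < length xs" "j < length xs"
    "{xs ! i, xs ! (Suc i mod length xs)} = {xs ! j, xs ! (Suc j mod length xs)}"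
  shows "i = j"
proof (rule ccontr)
  assume ne: "i \<noteq> j"
  let ?n = "length xs"
  have "xs ! i \<noteq> xs ! j" using assms ne by (simp add: nth_eq_iff_index_eq)
  then have swap: "xs ! i = xs ! (Suc j mod ?n)" "xs ! (Suc i mod ?n) = xs ! j"
    using assms(5) by (auto simp: doubleton_eq_iff)
  have "?n > 0" using assms(2) by linarith
  then have lt: "Suc j mod ?n < ?n" "Suc i mod ?n < ?n" by simp_all
  have "i = Suc j mod ?n" and "j = Suc i mod ?n"
    using swap assms(1,3,4) lt by (simp_all add: nth_eq_iff_index_eq)
  moreover have "Suc i mod ?n = (if Suc i = ?n then 0 else Suc i)" "Suc j mod ?n = (if Suc j = ?n then 0 else Suc j)"
    using assms(3,4) by auto
  ultimately have "i = 0 \<and> Suc j = ?n \<or> i = Suc j" "j = 0 \<and> Suc i = ?n \<or> j = Suc i"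
    by metis+
  then show False using assms(2) by linarith
qed

lemma card_closed_walk_edges:
  assumes "distinct xs" "length xs \<ge> 3"
  shows "card (closed_walk_edges xs) = length xs"
proof -
  have "closed_walk_edges xs = (\<lambda>i. {xs ! i, xs ! (Suc i mod length xs)}) ` {..<length xs}"
    by (auto simp: closed_walk_edges_def)
  moreover have "inj_on (\<lambda>i. {xs ! i, xs ! (Suc i mod length xs)}) {..<length xs}"
    using closed_walk_edge_inj[OF assms] by (auto intro!: inj_onI)
  ultimately show ?thesis by (simp add: card_image)
qed

text \<open>Split off from \<open>cactus\<close> because it passes to subgraphs, whereas
  connectedness has to be re-established for each component.\<close>

definition cactus_cycles :: "'a set set \<Rightarrow> bool" where
  "cactus_cycles E \<longleftrightarrow> (\<forall>C\<in>cycles E. \<forall>D\<in>cycles E. C \<noteq> D \<longrightarrow> card (\<Union>C \<inter> \<Union>D) \<le> 1)"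

lemma cycles_mono: "F \<subseteq> E \<Longrightarrow> cycles F \<subseteq> cycles E"
  unfolding cycles_def by (auto intro: subset_trans)

lemma cactus_cycles_subset: "cactus_cycles E \<Longrightarrow> F \<subseteq> E \<Longrightarrow> cactus_cycles F"
  unfolding cactus_cycles_def using cycles_mono by (meson subsetD)

text \<open>Covers cycles and bridges at once: for two vertices, \<open>closed_walk_edges\<close> is
  a single edge.\<close>

definition separating :: "'a set set \<Rightarrow> 'a list \<Rightarrow> bool" where
  "separating E xs \<longleftrightarrow> distinct xs \<and> length xs \<ge> 2 \<and> closed_walk_edges xs \<subseteq> E \<and>
    (\<forall>i<length xs. \<forall>j<length xs. (xs ! i, xs ! j) \<in> (adj (E - closed_walk_edges xs))\<^sup>* \<longrightarrow> i = j)"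

lemma separatingD:
  assumes "separating E xs"
  shows "distinct xs" "length xs \<ge> 2" "closed_walk_edges xs \<subseteq> E" "xs \<noteq> []"
proof -
  show "distinct xs" "length xs \<ge> 2" "closed_walk_edges xs \<subseteq> E" using assms by (simp_all only: separating_def)
  then show "xs \<noteq> []" by (cases xs) simp_all
qed

text \<open>A detour from \<open>xs ! i\<close> to \<open>xs ! j\<close> outside the cycle, together
  with the arc from \<open>xs ! j\<close> back to \<open>xs ! Suc i\<close>, yields a cycle through
  edge \<open>i\<close> of the given one. Leaving out edge \<open>j\<close> as well makes the new
  cycle different, yet both contain the two ends of edge \<open>i\<close>.\<close>

lemma cycle_not_connected_outside:
  assumes E: "cactus_cycles E" and xs: "distinct xs" "length xs \<ge> 3" "closed_walk_edges xs \<subseteq> E"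
    and ij: "i < j" "j < length xs"
  shows "(xs ! i, xs ! j) \<notin> (adj (E - closed_walk_edges xs))\<^sup>*"
proof
  let ?n = "length xs" and ?C = "closed_walk_edges xs"
  assume path: "(xs ! i, xs ! j) \<in> (adj (E - ?C))\<^sup>*"
  define ed where "ed k = {xs ! k, xs ! (Suc k mod ?n)}" for k
  have ed: "ed k \<in> ?C" if "k < ?n" for k using that by (auto simp: ed_def closed_walk_edges_def)
  have ed_inj: "ed k = ed l \<longleftrightarrow> k = l" if "k < ?n" "l < ?n" for k l
    using closed_walk_edge_inj[OF xs(1,2) that] by (auto simp: ed_def)
  define E' where "E' = E - {ed j}"
  have i': "Suc i < ?n" using ij by simp
  have edi: "ed i = {xs ! i, xs ! Suc i}" using i' by (simp add: ed_def)
  have ne: "xs ! i \<noteq> xs ! Suc i" using xs(1) i' by (simp add: nth_eq_iff_index_eq)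
  have "(xs ! i, xs ! j) \<in> (adj (E' - {ed i}))\<^sup>*"
    using path adj_mono[of "E - ?C" "E' - {ed i}"] ed[of i] ed[of j] ij unfolding E'_def by auto
  moreover have "(xs ! Suc i, xs ! Suc (i + k)) \<in> (adj (E' - {ed i}))\<^sup>*" if "Suc (i + k) \<le> j" for k
    using that
  proof (induction k)
    case (Suc k)
    have "ed (Suc (i + k)) \<in> E' - {ed i}"
      using ed[of "Suc (i + k)"] xs(3) Suc.prems ij ed_inj[of "Suc (i + k)" j] ed_inj[of "Suc (i + k)" i] unfolding E'_def by auto
    then have "(xs ! Suc (i + k), xs ! Suc (i + Suc k)) \<in> adj (E' - {ed i})"
      using Suc.prems ij by (simp add: ed_def)
    moreover have "(xs ! Suc i, xs ! Suc (i + k)) \<in> (adj (E' - {ed i}))\<^sup>*" using Suc by simp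
    ultimately show ?case by (rule rtrancl.rtrancl_into_rtrancl[rotated])
  qed simp
  from this[of "j - Suc i"] have "(xs ! Suc i, xs ! j) \<in> (adj (E' - {ed i}))\<^sup>*" using ij by simp
  then have "(xs ! j, xs ! Suc i) \<in> (adj (E' - {ed i}))\<^sup>*" by (rule adj_sym)
  ultimately have "(xs ! i, xs ! Suc i) \<in> (adj (E' - {ed i}))\<^sup>*" by (rule rtrancl_trans)
  moreover have "ed i \<in> E'" using ed[of i] xs(3) ed_inj[of i j] ij unfolding E'_def by auto
  ultimately obtain ys where ys: "distinct ys" "length ys \<ge> 3" "closed_walk_edges ys \<subseteq> E'" "ed i \<in> closed_walk_edges ys"
    using cycle_through_edge[of "xs ! i" "xs ! Suc i" E'] ne unfolding edi by blast
  have "?C \<in> cycles E" using xs unfolding cycles_def by blast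
  moreover have "closed_walk_edges ys \<in> cycles E" using ys unfolding cycles_def E'_def by blast
  moreover have "?C \<noteq> closed_walk_edges ys" using ys(3) ed[of j] ij unfolding E'_def by blast
  ultimately have "card (\<Union>?C \<inter> \<Union>(closed_walk_edges ys)) \<le> 1" using E unfolding cactus_cycles_def by blast
  moreover have "{xs ! i, xs ! Suc i} \<subseteq> \<Union>?C \<inter> \<Union>(closed_walk_edges ys)"
    using Union_upper[OF ys(4)] Union_upper[OF ed[of i]] ij unfolding edi by simp
  moreover have "finite (\<Union>?C)" using Union_closed_walk_edges[of xs] xs(2) by (cases xs) auto
  ultimately have "card {xs ! i, xs ! Suc i} \<le> 1" by (meson card_mono finite_Int le_trans)
  then show False using ne by simp
qed

lemma cycle_separating:
  assumes "cactus_cycles E" "distinct xs" "length xs \<ge> 3" "closed_walk_edges xs \<subseteq> E"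
  shows "separating E xs"
proof -
  have "i = j" if "(xs ! i, xs ! j) \<in> (adj (E - closed_walk_edges xs))\<^sup>*" "i < length xs" "j < length xs" for i j
  proof (cases i j rule: linorder_cases)
    case less
    show ?thesis using cycle_not_connected_outside[OF assms less that(3)] that(1) by (rule notE)
  next
    case greater
    show ?thesis using cycle_not_connected_outside[OF assms greater that(2)] adj_sym[OF that(1)] by (rule notE)
  qed
  then show ?thesis unfolding separating_def using assms by auto
qed

lemma bridge_separating:
  assumes "{v, u} \<in> E" "v \<noteq> u" "(v, u) \<notin> (adj (E - {{v, u}}))\<^sup>*"
  shows "separating E [v, u]"
proof -
  have C: "closed_walk_edges [v, u] = {{v, u}}"
    by (auto simp: closed_walk_edges_def less_Suc_eq insert_commute intro: exI[of _ 0])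
  show ?thesis unfolding separating_def C using assms adj_sym[of u v "E - {{v, u}}"]
    by (auto simp: less_Suc_eq)
qed

section \<open>Components hanging at a separator\<close>

definition component :: "'a set set \<Rightarrow> 'a list \<Rightarrow> nat \<Rightarrow> 'a set" where
  "component E xs i = {w. (xs ! i, w) \<in> (adj (E - closed_walk_edges xs))\<^sup>*}"

definition component_edges :: "'a set set \<Rightarrow> 'a list \<Rightarrow> nat \<Rightarrow> 'a set set" where
  "component_edges E xs i = {e \<in> E - closed_walk_edges xs. e \<subseteq> component E xs i}"

lemma component_root: "xs ! i \<in> component E xs i"
  by (simp add: component_def)

lemma component_step:
  assumes "u \<in> component E xs i" "{w, u} \<in> E - closed_walk_edges xs"
  shows "w \<in> component E xs i"
proof -
  have "(u, w) \<in> adj (E - closed_walk_edges xs)" using assms(2) by (simp add: insert_commute)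
  moreover have "(xs ! i, u) \<in> (adj (E - closed_walk_edges xs))\<^sup>*" using assms(1) by (simp add: component_def)
  ultimately have "(xs ! i, w) \<in> (adj (E - closed_walk_edges xs))\<^sup>*"
    by (rule rtrancl.rtrancl_into_rtrancl[rotated])
  then show ?thesis by (simp add: component_def)
qed

lemma component_unique:
  assumes "separating E xs" "i < length xs" "j < length xs" "w \<in> component E xs i" "w \<in> component E xs j"
  shows "i = j"
proof -
  have w: "(xs ! i, w) \<in> (adj (E - closed_walk_edges xs))\<^sup>*" "(xs ! j, w) \<in> (adj (E - closed_walk_edges xs))\<^sup>*"
    using assms(4,5) by (auto simp: component_def)
  have "(xs ! i, xs ! j) \<in> (adj (E - closed_walk_edges xs))\<^sup>*"
    by (rule rtrancl_trans[OF w(1) adj_sym[OF w(2)]])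
  then show ?thesis using assms(1-3) unfolding separating_def by blast
qed

lemma separating_vertices:
  assumes "simple_graph V E" "separating E xs"
  shows "set xs \<subseteq> V"
proof -
  have "xs \<noteq> []" using separatingD(4)[OF assms(2)] .
  then have "set xs = \<Union> (closed_walk_edges xs)" by (rule Union_closed_walk_edges[symmetric])
  then show ?thesis using assms(1) separatingD(3)[OF assms(2)] unfolding simple_graph_def by blast
qed

lemma UN_components:
  assumes G: "simple_graph V E" "connected_graph V E" and sep: "separating E xs"
  shows "(\<Union>i<length xs. component E xs i) = V"
proof
  have xsV: "set xs \<subseteq> V" using separating_vertices[OF G(1) sep] .
  have edge: "y \<in> V" if "{x, y} \<in> E" for x y using that G(1) unfolding simple_graph_def by blast
  have "w \<in> V" if "(a, w) \<in> (adj (E - closed_walk_edges xs))\<^sup>*" "a \<in> V" for a w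
    using that by (induction rule: rtrancl_induct) (auto intro: edge)
  note reach = this
  have "component E xs i \<subseteq> V" if "i < length xs" for i
    using reach[of "xs ! i"] nth_mem[OF that] xsV unfolding component_def by blast
  then show "(\<Union>i<length xs. component E xs i) \<subseteq> V" by blast
  have len: "0 < length xs" using separatingD(4)[OF sep] by simp
  have "\<exists>i<length xs. w \<in> component E xs i" if "(xs ! 0, w) \<in> (adj E)\<^sup>*" for w
    using that
  proof (induction rule: rtrancl_induct)
    case base
    then show ?case using len component_root by blast
  next
    case (step y z)
    show ?case
    proof (cases "{z, y} \<in> closed_walk_edges xs")
      case True
      then have "z \<in> set xs" using Union_closed_walk_edges[of xs] len by fastforce
      then show ?thesis using component_root by (metis in_set_conv_nth)
    next
      case False
      then show ?thesis using step component_step[of y E xs _ z] by (auto simp: insert_commute)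
    qed
  qed
  note covered = this
  have x0: "xs ! 0 \<in> V" using xsV nth_mem[OF len] by blast
  show "V \<subseteq> (\<Union>i<length xs. component E xs i)"
  proof
    fix w assume "w \<in> V"
    then have "(xs ! 0, w) \<in> (adj E)\<^sup>*" using G(2) x0 unfolding connected_graph_def by blast
    from covered[OF this] show "w \<in> (\<Union>i<length xs. component E xs i)" by blast
  qed
qed

lemma component_graph:
  assumes G: "simple_graph V E" "connected_graph V E" and sep: "separating E xs" and i: "i < length xs"
  shows "simple_graph (component E xs i) (component_edges E xs i)"
    and "connected_graph (component E xs i) (component_edges E xs i)"
proof -
  let ?F = "component_edges E xs i"
  have "component E xs i \<subseteq> V" using UN_components[OF assms(1-3)] i by blast
  then show "simple_graph (component E xs i) ?F"
    using G(1) finite_subset unfolding simple_graph_def component_edges_def by blast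
  have "(xs ! i, w) \<in> (adj ?F)\<^sup>*" if "(xs ! i, w) \<in> (adj (E - closed_walk_edges xs))\<^sup>*" for w
    using that
  proof (induction rule: rtrancl_induct)
    case (step y z)
    have "y \<in> component E xs i" using step.hyps(1) by (simp add: component_def)
    moreover have "{z, y} \<in> E - closed_walk_edges xs" using step.hyps(2) by (simp add: insert_commute)
    ultimately have "{y, z} \<in> ?F"
      using component_step[of y E xs i z] unfolding component_edges_def by (auto simp: insert_commute)
    then have "(y, z) \<in> adj ?F" by simp
    with step.IH show ?case by (rule rtrancl.rtrancl_into_rtrancl)
  qed simp
  then have *: "(xs ! i, w) \<in> (adj ?F)\<^sup>*" if "w \<in> component E xs i" for w using that by (simp add: component_def)
  have "(u, w) \<in> (adj ?F)\<^sup>*" if "u \<in> component E xs i" "w \<in> component E xs i" for u w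
    using rtrancl_trans[OF adj_sym[OF *] *] that by blast
  then show "connected_graph (component E xs i) ?F"
    using component_root[of xs i E] unfolding connected_graph_def by blast
qed

text \<open>A component contains no vertex of the separator besides its root, so the root alone sees
  anything outside.\<close>

lemma neighbors_component:
  assumes sep: "separating E xs" and i: "i < length xs" and u: "u \<in> component E xs i"
  shows "neighbors E u = neighbors (component_edges E xs i) u \<union>
    (if u = xs ! i then {xs ! ((i + length xs - 1) mod length xs), xs ! (Suc i mod length xs)} else {})"
proof -
  let ?C = "closed_walk_edges xs"
  have xs: "distinct xs" "?C \<subseteq> E" using separatingD[OF sep] by blast+
  have "neighbors E u = neighbors (E - ?C) u \<union> neighbors ?C u" using xs(2) unfolding neighbors_def by blast
  moreover have "neighbors (E - ?C) u = neighbors (component_edges E xs i) u"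
    using component_step[OF u] u unfolding neighbors_def component_edges_def by auto
  moreover have "neighbors ?C u = {}" if "u \<noteq> xs ! i"
  proof -
    have "u \<notin> set xs"
    proof
      assume "u \<in> set xs"
      then obtain j where "j < length xs" "u = xs ! j" by (metis in_set_conv_nth)
      then show False using component_unique[OF sep i, of j u] u component_root[of xs j E] that by auto
    qed
    moreover have "xs \<noteq> []" using i by auto
    ultimately show ?thesis using Union_closed_walk_edges[of xs] unfolding neighbors_def by blast
  qed
  ultimately show ?thesis using neighbors_closed_walk[OF xs(1) i] by auto
qed

section \<open>Losing with two colours at the root\<close>

definition loses_rooted :: "'a set \<Rightarrow> 'a set set \<Rightarrow> nat \<Rightarrow> 'a \<Rightarrow> bool" where
  "loses_rooted V E q v \<longleftrightarrow> (\<forall>f. sees_neighbors V E f \<longrightarrow> (\<forall>x<q. \<forall>x'<q. x \<noteq> x' \<longrightarrow>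
    (\<exists>c. (\<forall>u\<in>V. c u < q \<and> f u c \<noteq> c u) \<and> c v \<in> {x, x'})))"

lemma reduce_to_cycle:
  assumes G: "simple_graph V E" "connected_graph V E" and sep: "separating E xs"
    and lose: "\<And>i. i < length xs \<Longrightarrow> loses_rooted (component E xs i) (component_edges E xs i) q (xs ! i)"
    and f: "sees_neighbors V E f"
  shows "\<exists>G. \<forall>y. all_wrong q (length xs) G y \<longrightarrow>
    (\<exists>c. (\<forall>u\<in>V. c u < q \<and> f u c \<noteq> c u) \<and> (\<forall>i<length xs. c (xs ! i) = y i))"
proof -
  define n where "n = length xs"
  define K where "K i = component E xs i" for i
  define prev where "prev i = (i + n - 1) mod n" for i
  define nxt where "nxt i = Suc i mod n" for i
  have n: "n \<ge> 2" and dist: "distinct xs" using separatingD[OF sep] unfolding n_def by blast+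
  have V: "V = (\<Union>i<n. K i)" using UN_components[OF G sep] by (simp add: n_def K_def)
  have uniq: "i = j" if "i < n" "j < n" "w \<in> K i" "w \<in> K j" for i j w
    using component_unique[OF sep] that unfolding n_def K_def by blast
  have root: "xs ! i \<in> K i" for i unfolding K_def by (rule component_root)
  have nb: "neighbors E u = neighbors (component_edges E xs i) u \<union> (if u = xs ! i then {xs ! prev i, xs ! nxt i} else {})"
    if "i < n" "u \<in> K i" for i u
    using neighbors_component[OF sep] that unfolding n_def K_def prev_def nxt_def by blast
  have nbK: "neighbors (component_edges E xs i) u \<subseteq> K i" for i u
    unfolding neighbors_def component_edges_def K_def by blast
  \<comment> \<open>The cycle neighbours of root \<open>i\<close> lie in other components, so their
    colours enter the game on the component as parameters \<open>l\<close> and \<open>r\<close>. For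
    a bridge both updates hit the same vertex, and the parameters used in the end are equal.\<close>
  define up where "up i l r c = (c(xs ! prev i := l))(xs ! nxt i := r)" for i and l r :: nat and c :: "'a \<Rightarrow> nat"
  have pn: "prev i < n" "nxt i < n" "prev i \<noteq> i" "nxt i \<noteq> i" if "i < n" for i
    using that n by (auto simp: prev_def nxt_def mod_if split: if_splits)
  have up_same: "up i l r c u = c u" if "i < n" "u \<in> K i" for i l r c u
  proof -
    have "u \<noteq> xs ! prev i" "u \<noteq> xs ! nxt i" using uniq root pn that by metis+
    then show ?thesis by (simp add: up_def)
  qed
  have "\<exists>g. \<forall>y<q. y \<noteq> g \<longrightarrow> (\<exists>c. (\<forall>u\<in>K i. c u < q \<and> f u (up i l r c) \<noteq> c u) \<and> c (xs ! i) = y)" if i: "i < n" for i l r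
  proof -
    have "sees_neighbors (K i) (component_edges E xs i) (\<lambda>u c. f u (up i l r c))"
      unfolding sees_neighbors_def
    proof (intro ballI allI impI)
      fix u and c c' :: "'a \<Rightarrow> nat" assume u: "u \<in> K i" and c: "\<forall>w\<in>neighbors (component_edges E xs i) u. c w = c' w"
      have "up i l r c w = up i l r c' w" if "w \<in> neighbors E u" for w
        using nb[OF i u] c that by (auto simp: up_def split: if_splits)
      moreover have "u \<in> V" using u i V by blast
      ultimately show "f u (up i l r c) = f u (up i l r c')" using f unfolding sees_neighbors_def by blast
    qed
    then have *: "\<exists>c. (\<forall>u\<in>K i. c u < q \<and> f u (up i l r c) \<noteq> c u) \<and> c (xs ! i) \<in> {x, x'}"
      if "x < q" "x' < q" "x \<noteq> x'" for x x'
      using lose[of i] i that unfolding loses_rooted_def K_def n_def by blast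
    \<comment> \<open>Two different root colours without a losing colouring would contradict strong
      losing. At most one such colour exists, and it serves as the guess \<open>g\<close>.\<close>
    show ?thesis
    proof (rule ccontr)
      assume no: "\<nexists>g. \<forall>y<q. y \<noteq> g \<longrightarrow> (\<exists>c. (\<forall>u\<in>K i. c u < q \<and> f u (up i l r c) \<noteq> c u) \<and> c (xs ! i) = y)"
      then obtain x where x: "x < q" "\<not> (\<exists>c. (\<forall>u\<in>K i. c u < q \<and> f u (up i l r c) \<noteq> c u) \<and> c (xs ! i) = x)" by blast
      obtain x' where x': "x' < q" "x' \<noteq> x" "\<not> (\<exists>c. (\<forall>u\<in>K i. c u < q \<and> f u (up i l r c) \<noteq> c u) \<and> c (xs ! i) = x')"
        using no by blast
      show False using *[OF x(1) x'(1) x'(2)[symmetric]] x(2) x'(3) by blast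
    qed
  qed
  note ex_g = this
  define G where "G i l r = (SOME g. \<forall>y<q. y \<noteq> g \<longrightarrow>
    (\<exists>c. (\<forall>u\<in>K i. c u < q \<and> f u (up i l r c) \<noteq> c u) \<and> c (xs ! i) = y))" for i l r
  have G: "\<exists>c. (\<forall>u\<in>K i. c u < q \<and> f u (up i l r c) \<noteq> c u) \<and> c (xs ! i) = y"
    if "i < n" "y < q" "y \<noteq> G i l r" for i l r y
    using someI_ex[OF ex_g[OF that(1), of l r]] that(2,3) unfolding G_def by blast
  have "\<exists>c. (\<forall>u\<in>V. c u < q \<and> f u c \<noteq> c u) \<and> (\<forall>i<n. c (xs ! i) = y i)" if y: "all_wrong q n G y" for y
  proof -
    have "\<exists>c. (\<forall>u\<in>K i. c u < q \<and> f u (up i (y (prev i)) (y (nxt i)) c) \<noteq> c u) \<and> c (xs ! i) = y i" if "i < n" for i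
      by (rule G[OF that]) (use y that in \<open>auto simp: all_wrong_def prev_def nxt_def\<close>)
    then obtain cc where cc: "\<And>i u. i < n \<Longrightarrow> u \<in> K i \<Longrightarrow> cc i u < q \<and> f u (up i (y (prev i)) (y (nxt i)) (cc i)) \<noteq> cc i u"
      "\<And>i. i < n \<Longrightarrow> cc i (xs ! i) = y i" by metis
    \<comment> \<open>The components partition \<open>V\<close>, so the colourings chosen on each
      can be assembled. An edge between two components belongs to the separator, and there the
      colours are the prescribed \<open>y\<close>.\<close>
    define c where "c u = cc (THE i. i < n \<and> u \<in> K i) u" for u
    have c: "c u = cc i u" if "i < n" "u \<in> K i" for i u
    proof -
      have "(THE j. j < n \<and> u \<in> K j) = i" using uniq that by (intro the_equality) auto
      then show ?thesis by (simp add: c_def)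
    qed
    have cy: "c (xs ! i) = y i" if "i < n" for i using c[OF that root] cc(2) that by simp
    have "c u < q \<and> f u c \<noteq> c u" if "u \<in> V" for u
    proof -
      obtain i where i: "i < n" "u \<in> K i" using \<open>u \<in> V\<close> V by blast
      have "c w = up i (y (prev i)) (y (nxt i)) (cc i) w" if "w \<in> neighbors E u" for w
      proof (cases "w \<in> K i")
        case True
        then show ?thesis using c up_same i by simp
      next
        case False
        then have "w \<in> {xs ! prev i, xs ! nxt i}" using nb[OF i] nbK that by (auto split: if_splits)
        then show ?thesis using cy pn[OF i(1)] dist unfolding up_def n_def
          by (auto simp: nth_eq_iff_index_eq)
      qed
      then have "f u c = f u (up i (y (prev i)) (y (nxt i)) (cc i))"
        using f \<open>u \<in> V\<close> unfolding sees_neighbors_def by blast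
      then show ?thesis using cc(1)[OF i] c[OF i] by simp
    qed
    then show ?thesis using cy by blast
  qed
  then show ?thesis unfolding n_def by blast
qed

lemma card_component_edges:
  assumes "simple_graph V E" "separating E xs"
  shows "card (component_edges E xs i) < card E"
proof -
  have "finite E" using assms(1) unfolding simple_graph_def by (meson PowI finite_Pow_iff finite_subset subsetI)
  moreover have "closed_walk_edges xs \<noteq> {}" "closed_walk_edges xs \<subseteq> E"
    using Union_closed_walk_edges[OF separatingD(4)[OF assms(2)]] separatingD(3,4)[OF assms(2)] by auto
  then have "component_edges E xs i \<subset> E" unfolding component_edges_def by blast
  ultimately show ?thesis by (rule psubset_card_mono)
qed

lemma simple_edge_neq:
  assumes "simple_graph V E" "{v, u} \<in> E"
  shows "v \<noteq> u"
  using assms unfolding simple_graph_def by fastforce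

text \<open>An edge at \<open>v\<close> either lies on a cycle, which can be listed from
  \<open>v\<close> on, or is a bridge.\<close>

lemma separating_at_vertex:
  assumes G: "simple_graph V E" "connected_graph V E" "cactus_cycles E" and v: "v \<in> V" and E: "E \<noteq> {}"
  shows "\<exists>xs. separating E xs \<and> xs ! 0 = v \<and> (length xs = 2 \<or> closed_walk_edges xs \<in> cycles E \<and> length xs = card (closed_walk_edges xs))"
proof -
  obtain e where "e \<in> E" using E by blast
  then have "card e = 2" "e \<subseteq> V" using G(1) unfolding simple_graph_def by auto
  then obtain w where w: "w \<in> V" "w \<noteq> v" by (auto simp: card_2_iff)
  then have "(v, w) \<in> (adj E)\<^sup>*" using G(2) v unfolding connected_graph_def by blast
  then obtain u where u: "{v, u} \<in> E" using w(2) by (cases rule: converse_rtranclE) auto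
  have vu: "v \<noteq> u" using simple_edge_neq[OF G(1) u] .
  show ?thesis
  proof (cases "(v, u) \<in> (adj (E - {{v, u}}))\<^sup>*")
    case True
    from cycle_through_edge[OF u vu True] obtain xs where xs: "distinct xs" "3 \<le> length xs" "xs ! 0 = v"
      "closed_walk_edges xs \<subseteq> E" by blast
    then have "separating E xs" "closed_walk_edges xs \<in> cycles E"
      using cycle_separating[OF G(3)] unfolding cycles_def by auto
    then show ?thesis using xs card_closed_walk_edges[OF xs(1,2)] by metis
  next
    case False
    then have "separating E [v, u]" using bridge_separating[OF u vu] by blast
    then show ?thesis by (intro exI[of _ "[v, u]"]) auto
  qed
qed

lemma loses_rooted_trivial:
  assumes "connected_graph V {}" "v \<in> V"
  shows "loses_rooted V {} q v"
proof -
  have "w = v" if "w \<in> V" for w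
  proof -
    have "(v, w) \<in> (adj {})\<^sup>*" using that assms unfolding connected_graph_def by blast
    then show ?thesis by (cases rule: rtranclE) auto
  qed
  then have V: "V = {v}" using assms(2) by blast
  have nb: "neighbors {} v = {}" by (simp add: neighbors_def)
  show ?thesis unfolding loses_rooted_def
  proof (intro allI impI)
    fix f and x x' :: nat assume f: "sees_neighbors V {} f" and x: "x < q" "x' < q" "x \<noteq> x'"
    define g where "g = f v (\<lambda>_. 0)"
    have g: "f v c = g" for c using f nb V unfolding sees_neighbors_def g_def by blast
    obtain y where "y \<in> {x, x'}" "y \<noteq> g" using x by auto
    then show "\<exists>c. (\<forall>u\<in>V. c u < q \<and> f u c \<noteq> c u) \<and> c v \<in> {x, x'}"
      using x by (intro exI[of _ "\<lambda>_. y"]) (auto simp: V g)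
  qed
qed

text \<open>Induction on the number of edges. Every vertex of a separator through \<open>v\<close>
  is the root of a component that is strongly losing by induction; as \<open>v\<close> is vertex 0
  of the separator, its two colours are passed on to \<open>cycle_loses_rooted\<close>.\<close>

lemma cactus_loses_rooted:
  assumes "simple_graph V E" "connected_graph V E" "cactus_cycles E"
    and "\<And>C. C \<in> cycles E \<Longrightarrow> cycle_loses_rooted q (card C)"
    and q2: "cycle_loses_rooted q 2" and "v \<in> V"
  shows "loses_rooted V E q v"
  using assms(1-4,6)
proof (induction "card E" arbitrary: V E v rule: less_induct)
  case less
  note G = less.prems(1-3)
  show ?case
  proof (cases "E = {}")
    case True
    then show ?thesis using loses_rooted_trivial[of V v q] less.prems(2,5) by simp
  next
    case False
    obtain xs where sep: "separating E xs" and x0: "xs ! 0 = v"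
      and len: "length xs = 2 \<or> closed_walk_edges xs \<in> cycles E \<and> length xs = card (closed_walk_edges xs)"
      using separating_at_vertex[OF G less.prems(5) False] by blast
    have loseC: "cycle_loses_rooted q (length xs)" using len q2 less.prems(4) by metis
    have "loses_rooted (component E xs i) (component_edges E xs i) q (xs ! i)" if i: "i < length xs" for i
    proof (rule less.hyps)
      have sub: "component_edges E xs i \<subseteq> E" by (auto simp: component_edges_def)
      show "card (component_edges E xs i) < card E" by (rule card_component_edges[OF G(1) sep])
      show "simple_graph (component E xs i) (component_edges E xs i)"
        "connected_graph (component E xs i) (component_edges E xs i)"
        using component_graph[OF G(1,2) sep i] by auto
      show "cactus_cycles (component_edges E xs i)" by (rule cactus_cycles_subset[OF G(3) sub])
      show "cycle_loses_rooted q (card C)" if "C \<in> cycles (component_edges E xs i)" for C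
        using that cycles_mono[OF sub] less.prems(4) by blast
      show "xs ! i \<in> component E xs i" by (rule component_root)
    qed
    note reduce = reduce_to_cycle[OF G(1,2) sep this]
    show ?thesis unfolding loses_rooted_def
    proof (intro allI impI)
      fix f and x x' :: nat assume f: "sees_neighbors V E f" and x: "x < q" "x' < q" "x \<noteq> x'"
      obtain g where g: "\<forall>y. all_wrong q (length xs) g y \<longrightarrow>
        (\<exists>c. (\<forall>u\<in>V. c u < q \<and> f u c \<noteq> c u) \<and> (\<forall>i<length xs. c (xs ! i) = y i))" using reduce[OF _ f] by blast
      obtain y where y: "all_wrong q (length xs) g y" "y 0 \<in> {x, x'}"
        using loseC x unfolding cycle_loses_rooted_def by blast
      obtain c where c: "\<forall>u\<in>V. c u < q \<and> f u c \<noteq> c u" "\<forall>i<length xs. c (xs ! i) = y i" using g y(1) by blast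
      have "0 < length xs" using separatingD(4)[OF sep] by simp
      then have "c v = y 0" using c(2) x0 by blast
      then show "\<exists>c. (\<forall>u\<in>V. c u < q \<and> f u c \<noteq> c u) \<and> c v \<in> {x, x'}" using c(1) y(2) by metis
    qed
  qed
qed

lemma loses_rooted_not_wins:
  assumes "loses_rooted V E q v" "q \<ge> 2"
  shows "\<not> wins V E (\<lambda>_. q)"
proof
  assume "wins V E (\<lambda>_. q)"
  then obtain f where f: "sees_neighbors V E f" "\<And>c. \<forall>v\<in>V. c v < q \<Longrightarrow> \<exists>v\<in>V. f v c = c v"
    unfolding wins_def by blast
  have "0 < q" "1 < q" using assms(2) by auto
  then obtain c where "\<forall>u\<in>V. c u < q \<and> f u c \<noteq> c u"
    using assms(1) f(1) unfolding loses_rooted_def by (metis zero_neq_one)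
  then show False using f(2)[of c] by blast
qed

text \<open>The one cycle that merely loses is taken as the separator; every cycle left in a
  component is a different one and hence strongly losing.\<close>

lemma cactus_loses_at_cycle:
  assumes G: "simple_graph V E" "connected_graph V E" "cactus_cycles E"
    and C: "C \<in> cycles E" "cycle_loses q (card C)"
    and D: "\<And>D. D \<in> cycles E \<Longrightarrow> D \<noteq> C \<Longrightarrow> cycle_loses_rooted q (card D)"
    and q2: "cycle_loses_rooted q 2"
  shows "\<not> wins V E (\<lambda>_. q)"
proof
  assume "wins V E (\<lambda>_. q)"
  then obtain f where f: "sees_neighbors V E f" "\<And>c. \<forall>v\<in>V. c v < q \<Longrightarrow> \<exists>v\<in>V. f v c = c v"
    unfolding wins_def by blast
  obtain xs where xs: "distinct xs" "length xs \<ge> 3" "C = closed_walk_edges xs" "C \<subseteq> E"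
    using C(1) unfolding cycles_def by blast
  have sep: "separating E xs" using cycle_separating[OF G(3)] xs by blast
  have "loses_rooted (component E xs i) (component_edges E xs i) q (xs ! i)" if i: "i < length xs" for i
  proof (rule cactus_loses_rooted)
    have sub: "component_edges E xs i \<subseteq> E" by (auto simp: component_edges_def)
    show "simple_graph (component E xs i) (component_edges E xs i)"
      "connected_graph (component E xs i) (component_edges E xs i)"
      using component_graph[OF G(1,2) sep i] by auto
    show "cactus_cycles (component_edges E xs i)" by (rule cactus_cycles_subset[OF G(3) sub])
    show "cycle_loses_rooted q (card B)" if B: "B \<in> cycles (component_edges E xs i)" for B
    proof (rule D)
      show "B \<in> cycles E" using B cycles_mono[OF sub] by blast
      have "B \<noteq> {}" using B card_closed_walk_edges unfolding cycles_def by fastforce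
      moreover have "B \<inter> C = {}" using B xs(3) unfolding cycles_def component_edges_def by blast
      ultimately show "B \<noteq> C" by blast
    qed
  qed (use q2 component_root in auto)
  from reduce_to_cycle[OF G(1,2) sep this f(1)] obtain g where
    g: "\<forall>y. all_wrong q (length xs) g y \<longrightarrow> (\<exists>c. \<forall>u\<in>V. c u < q \<and> f u c \<noteq> c u)" by blast
  have "card C = length xs" using card_closed_walk_edges xs by blast
  then obtain y where "all_wrong q (length xs) g y" using C(2) unfolding cycle_loses_def by metis
  then obtain c where "\<forall>u\<in>V. c u < q \<and> f u c \<noteq> c u" using g by blast
  then show False using f(2)[of c] by blast
qed

section \<open>Winning games\<close>

lemma winsE:
  assumes "wins V E h"
  obtains f where "sees_neighbors V E f" "\<And>c. (\<And>v. v \<in> V \<Longrightarrow> c v < h v) \<Longrightarrow> \<exists>v\<in>V. f v c = c v"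
  using assms unfolding wins_def by blast

lemma winsI:
  assumes "sees_neighbors V E f" "\<And>c. (\<And>v. v \<in> V \<Longrightarrow> c v < h v) \<Longrightarrow> \<exists>v\<in>V. f v c = c v"
  shows "wins V E h"
  using assms unfolding wins_def by blast

lemma wins_mono:
  assumes "wins V E h" "V \<subseteq> V'" "E \<subseteq> E'" "\<And>v. v \<in> V \<Longrightarrow> h' v \<le> h v"
  shows "wins V' E' h'"
proof -
  obtain f where f: "sees_neighbors V E f" "\<And>c. (\<And>v. v \<in> V \<Longrightarrow> c v < h v) \<Longrightarrow> \<exists>v\<in>V. f v c = c v"
    using winsE[OF assms(1)] by blast
  show ?thesis
  proof (rule winsI)
    have "neighbors E v \<subseteq> neighbors E' v" for v using assms(3) by (auto simp: neighbors_def)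
    then show "sees_neighbors V' E' (\<lambda>v. if v \<in> V then f v else (\<lambda>_. 0))"
      using f(1) unfolding sees_neighbors_def by (simp add: subset_iff)
    fix c assume c: "\<And>v. v \<in> V' \<Longrightarrow> c v < h' v"
    have "c v < h v" if "v \<in> V" for v using c[of v] assms(2,4) that by fastforce
    from f(2)[of c, OF this] show "\<exists>v\<in>V'. (if v \<in> V then f v else (\<lambda>_. 0)) c = c v"
      using assms(2) by auto
  qed
qed

text \<open>The colour of \<open>v\<close> in the glued game encodes a pair of colours, one for each of the two games.\<close>

lemma wins_glue:
  assumes 1: "wins V1 E h1" and 2: "wins V2 E h2" and v: "V1 \<inter> V2 = {v}" and irr: "{v} \<notin> E"
    and h: "h v \<le> h1 v * h2 v" "\<And>w. w \<in> V1 \<Longrightarrow> w \<noteq> v \<Longrightarrow> h w \<le> h1 w"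
      "\<And>w. w \<in> V2 \<Longrightarrow> w \<noteq> v \<Longrightarrow> h w \<le> h2 w"
  shows "wins (V1 \<union> V2) E h"
proof -
  obtain f1 where f1: "sees_neighbors V1 E f1" "\<And>c. (\<And>v. v \<in> V1 \<Longrightarrow> c v < h1 v) \<Longrightarrow> \<exists>v\<in>V1. f1 v c = c v"
    using winsE[OF 1] by blast
  obtain f2 where f2: "sees_neighbors V2 E f2" "\<And>c. (\<And>v. v \<in> V2 \<Longrightarrow> c v < h2 v) \<Longrightarrow> \<exists>v\<in>V2. f2 v c = c v"
    using winsE[OF 2] by blast
  have vV: "v \<in> V1" "v \<in> V2" using v by auto
  have nv: "v \<notin> neighbors E v" using irr by (simp add: neighbors_def)
  define m where "m = h1 v"
  define c1 where "c1 c = c(v := c v mod m)" for c :: "'a \<Rightarrow> nat"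
  define c2 where "c2 c = c(v := c v div m)" for c :: "'a \<Rightarrow> nat"
  \<comment> \<open>Vertices of the first game see the colour of \<open>v\<close> modulo
    \<open>m\<close>, those of the second see the quotient, and \<open>v\<close> combines its two
    guesses in the same way. If both games are won at \<open>v\<close>, the combined guess is right;
    otherwise some other vertex is right.\<close>
  define f where "f w c = (if w = v then f1 v c + m * f2 v c else if w \<in> V1 then f1 w (c1 c) else f2 w (c2 c))" for w c
  have s1: "f1 w c = f1 w c'" if "w \<in> V1" "\<forall>u\<in>neighbors E w. c u = c' u" for w c c'
    using f1(1) that unfolding sees_neighbors_def by blast
  have s2: "f2 w c = f2 w c'" if "w \<in> V2" "\<forall>u\<in>neighbors E w. c u = c' u" for w c c'
    using f2(1) that unfolding sees_neighbors_def by blast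
  show ?thesis
  proof (rule winsI)
    show "sees_neighbors (V1 \<union> V2) E f"
      unfolding sees_neighbors_def
    proof (intro ballI allI impI)
      fix w and c c' :: "'a \<Rightarrow> nat" assume w: "w \<in> V1 \<union> V2" and c: "\<forall>u\<in>neighbors E w. c u = c' u"
      have "\<forall>u\<in>neighbors E w. c1 c u = c1 c' u" "\<forall>u\<in>neighbors E w. c2 c u = c2 c' u"
        using c by (auto simp: c1_def c2_def)
      then show "f w c = f w c'"
        using w c vV s1[of w "c1 c" "c1 c'"] s2[of w "c2 c" "c2 c'"] s1[of v c c'] s2[of v c c'] unfolding f_def by auto
    qed
    fix c assume c: "\<And>w. w \<in> V1 \<union> V2 \<Longrightarrow> c w < h w"
    have cv: "c v < m * h2 v" using c[of v] vV h(1) unfolding m_def by auto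
    then have m: "0 < m" by (cases m) auto
    have "c1 c w < h1 w" if "w \<in> V1" for w
      using c[of w] h(2)[of w] that m by (cases "w = v") (auto simp: c1_def m_def)
    from f1(2)[of "c1 c", OF this] obtain w1 where w1: "w1 \<in> V1" "f1 w1 (c1 c) = c1 c w1" by blast
    have "c2 c w < h2 w" if "w \<in> V2" for w
      using c[of w] h(3)[of w] that cv by (cases "w = v") (auto simp: c2_def less_mult_imp_div_less mult.commute)
    from f2(2)[of "c2 c", OF this] obtain w2 where w2: "w2 \<in> V2" "f2 w2 (c2 c) = c2 c w2" by blast
    show "\<exists>w\<in>V1 \<union> V2. f w c = c w"
    proof (cases "w1 = v \<and> w2 = v")
      case True
      have "f1 v c = f1 v (c1 c)" "f2 v c = f2 v (c2 c)"
        using nv vV by (auto simp: c1_def c2_def intro!: s1 s2)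
      then have "f v c = c v mod m + m * (c v div m)" using w1 w2 True unfolding f_def by (simp add: c1_def c2_def)
      then have "f v c = c v" by simp
      then show ?thesis using vV by blast
    next
      case False
      have "f w1 c = c w1" if "w1 \<noteq> v" using w1 that by (simp add: f_def c1_def)
      moreover have "f w2 c = c w2" if "w2 \<noteq> v"
      proof -
        have "w2 \<notin> V1" using w2 that v by blast
        then show ?thesis using w2 that by (simp add: f_def c2_def)
      qed
      ultimately show ?thesis using False w1 w2 by blast
    qed
  qed
qed

lemma wins_edge:
  assumes "{a, b} \<in> E" "a \<noteq> b"
  shows "wins {a, b} E (\<lambda>_. 2)"
proof (rule winsI)
  have "b \<in> neighbors E a" "a \<in> neighbors E b" using assms(1) by (auto simp: neighbors_def insert_commute)
  \<comment> \<open>\<open>a\<close> guesses that the two colours are equal, \<open>b\<close> that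
    they differ.\<close>
  then show "sees_neighbors {a, b} E (\<lambda>v c. if v = a then c b else 1 - c a)"
    unfolding sees_neighbors_def by auto
  fix c assume "\<And>v. v \<in> {a, b} \<Longrightarrow> c v < (2::nat)"
  then have "c a < 2" "c b < 2" by auto
  then show "\<exists>v\<in>{a, b}. (if v = a then c b else 1 - c a) = c v" using assms(2) by auto
qed

section \<open>Explicit strategies on cycles\<close>

definition cycle_wins :: "nat \<Rightarrow> (nat \<Rightarrow> nat) \<Rightarrow> bool" where
  "cycle_wins n H \<longleftrightarrow> (\<exists>G. \<forall>y. (\<forall>i<n. y i < H i) \<longrightarrow>
    (\<exists>i<n. y i = G i (y ((i + n - 1) mod n)) (y (Suc i mod n))))"

lemma cycle_wins_imp_wins:
  assumes xs: "distinct xs" and win: "cycle_wins (length xs) H"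
    and h: "\<And>i. i < length xs \<Longrightarrow> h (xs ! i) \<le> H i"
  shows "wins (set xs) (closed_walk_edges xs) h"
proof -
  let ?n = "length xs"
  obtain G where G: "\<And>y. (\<forall>i<?n. y i < H i) \<Longrightarrow> \<exists>i<?n. y i = G i (y ((i + ?n - 1) mod ?n)) (y (Suc i mod ?n))"
    using win unfolding cycle_wins_def by blast
  define idx where "idx v = (THE i. i < ?n \<and> xs ! i = v)" for v
  have idx: "idx (xs ! i) = i" if "i < ?n" for i
    unfolding idx_def using that xs by (intro the_equality) (auto simp: nth_eq_iff_index_eq)
  define f where "f v c = G (idx v) (c (xs ! ((idx v + ?n - 1) mod ?n))) (c (xs ! (Suc (idx v) mod ?n)))"
    for v and c :: "'a \<Rightarrow> nat"
  show ?thesis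
  proof (rule winsI)
    show "sees_neighbors (set xs) (closed_walk_edges xs) f"
      unfolding sees_neighbors_def
    proof (intro ballI allI impI)
      fix v and c c' :: "'a \<Rightarrow> nat" assume "v \<in> set xs" and c: "\<forall>u\<in>neighbors (closed_walk_edges xs) v. c u = c' u"
      then obtain i where i: "i < ?n" "v = xs ! i" by (metis in_set_conv_nth)
      then show "f v c = f v c'" using c neighbors_closed_walk[OF xs i(1)] idx[OF i(1)] by (simp add: f_def)
    qed
    fix c assume c: "\<And>v. v \<in> set xs \<Longrightarrow> c v < h v"
    have "\<forall>i<?n. c (xs ! i) < H i" using c h by (meson nth_mem less_le_trans)
    from G[of "\<lambda>i. c (xs ! i)", OF this] obtain i where
      i: "i < ?n" "c (xs ! i) = G i (c (xs ! ((i + ?n - 1) mod ?n))) (c (xs ! (Suc i mod ?n)))" by blast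
    then have "f (xs ! i) c = c (xs ! i)" using idx[OF i(1)] by (simp add: f_def)
    then show "\<exists>v\<in>set xs. f v c = c v" using i(1) by auto
  qed
qed

lemma prev_mod: "0 < j \<Longrightarrow> j < n \<Longrightarrow> (j + n - 1) mod n = j - 1" for j n :: nat
  by (cases j) auto

lemma less_3_cases: "(x::nat) < 3 \<longleftrightarrow> x = 0 \<or> x = 1 \<or> x = 2"
  by auto

lemma less_4_cases: "(x::nat) < 4 \<longleftrightarrow> x = 0 \<or> x = 1 \<or> x = 2 \<or> x = 3"
  by auto

text \<open>Let S be \<open>y 1 + y 2\<close> modulo 4. Vertex 1 is right when S is
  \<open>2 * y 0\<close>, vertex 2 when S is \<open>2 * y 0 + 1\<close>, and vertex 0 guesses the
  colour for which S is neither. The constants 8 and 9 are 0 and 1 modulo 4, large enough to prevent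
  truncated subtraction.\<close>

lemma cycle_wins_2_4_4: "cycle_wins 3 (\<lambda>i. if i = 0 then 2 else 4)"
proof -
  define G :: "nat \<Rightarrow> nat \<Rightarrow> nat \<Rightarrow> nat" where
    "G i l r = (if i = 0 then if (l + r) mod 4 \<ge> 2 then 0 else 1
      else if i = 1 then (8 - (2 * l + r)) mod 4 else (9 - (l + 2 * r)) mod 4)" for i l r
  have "\<exists>i<3. y i = G i (y ((i + 3 - 1) mod 3)) (y (Suc i mod 3))"
    if y: "\<forall>i<3. y i < (if i = 0 then 2 else 4)" for y
  proof (rule ccontr)
    assume "\<not> ?thesis"
    then have w: "y i \<noteq> G i (y ((i + 3 - 1) mod 3)) (y (Suc i mod 3))" if "i < 3" for i using that by blast
    have "y 0 < 2" "y 1 < 4" "y 2 < 4" using y[rule_format, of 0] y[rule_format, of 1] y[rule_format, of 2] by auto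
    moreover have "y 0 \<noteq> G 0 (y 2) (y 1)" "y 1 \<noteq> G 1 (y 0) (y 2)" "y 2 \<noteq> G 2 (y 1) (y 0)"
      using w[of 0] w[of 1] w[of 2] by (simp_all flip: numeral_2_eq_2)
    ultimately show False unfolding less_4_cases less_2_cases_iff G_def by (elim disjE) simp_all
  qed
  then show ?thesis unfolding cycle_wins_def by blast
qed

text \<open>Let L0 to L3 be the differences, modulo 3, of each colour and its guess. The
  coefficients are such that L2 = L0 - L1 and L3 = -(L0 + L1). Nonzero L0 and L1 are equal or
  opposite, which makes L2 or L3 vanish.\<close>

lemma cycle_wins_4_3: "cycle_wins 4 (\<lambda>_. 3)"
proof -
  define G :: "nat \<Rightarrow> nat \<Rightarrow> nat \<Rightarrow> nat" where
    "G i l r = (if i = 0 then l + r else if i = 3 then 2 * l + 2 * r else 2 * l + r) mod 3" for i l r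
  have "\<exists>i<4. y i = G i (y ((i + 4 - 1) mod 4)) (y (Suc i mod 4))"
    if y: "\<forall>i<4. y i < 3" for y
  proof (rule ccontr)
    assume "\<not> ?thesis"
    then have w: "y i \<noteq> G i (y ((i + 4 - 1) mod 4)) (y (Suc i mod 4))" if "i < 4" for i using that by blast
    have "y 0 < 3" "y 1 < 3" "y 2 < 3" "y 3 < 3" using y by auto
    moreover have "y 0 \<noteq> G 0 (y 3) (y 1)" "y 1 \<noteq> G 1 (y 0) (y 2)" "y 2 \<noteq> G 2 (y 1) (y 3)" "y 3 \<noteq> G 3 (y 2) (y 0)"
      using w[of 0] w[of 1] w[of 2] w[of 3] by (simp_all flip: numeral_2_eq_2)
    ultimately show False unfolding less_3_cases G_def by (elim disjE) simp_all
  qed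
  then show ?thesis unfolding cycle_wins_def by blast
qed

text \<open>A wrong guess under \<open>g\<close> means that the colour difference modulo 3, read as
  0, 1 or 2, does not grow from one edge to the next. Around the cycle all differences are then
  equal, and \<open>n\<close> equal ones add up to 0 as 3 divides \<open>n\<close>. The edge between
  \<open>n - 1\<close> and 0 is twisted by 1, so they would have to add up to 1.\<close>

lemma cycle_wins_3_dvd:
  assumes n: "n \<ge> 3" "3 dvd n"
  shows "cycle_wins n (\<lambda>_. 3)"
proof -
  define g :: "nat \<Rightarrow> nat \<Rightarrow> nat" where "g l r = (if l \<noteq> r then l else (l + 1) mod 3)" for l r
  define G :: "nat \<Rightarrow> nat \<Rightarrow> nat \<Rightarrow> nat" where
    "G i l r = (if i = 0 then g ((l + 2) mod 3) r else if i = n - 1 then g l ((r + 1) mod 3) else g l r)" for i l r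
  have "\<exists>i<n. y i = G i (y ((i + n - 1) mod n)) (y (Suc i mod n))" if y: "\<forall>i<n. y i < 3" for y
  proof (rule ccontr)
    assume "\<not> ?thesis"
    then have wr: "y i \<noteq> G i (y ((i + n - 1) mod n)) (y (Suc i mod n))" if "i < n" for i using that by blast
    \<comment> \<open>\<open>w n\<close> is the colour of vertex 0 as vertex \<open>n - 1\<close>
      sees it through the twist.\<close>
    define w where "w i = (if i = n then (y 0 + 1) mod 3 else y i)" for i
    define d where "d i = (w (Suc i) + 3 - w i) mod 3" for i
    have w3: "w i < 3" if "i \<le> n" for i using y that by (simp add: w_def)
    have key: "(c + 3 - b) mod 3 \<le> (b + 3 - a) mod 3" if "a < 3" "b < 3" "c < 3" "b \<noteq> g a c" for a b c
      using that unfolding less_3_cases g_def by (elim disjE) simp_all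
    have step: "d (Suc i) \<le> d i" if "Suc i < n" for i
    proof -
      have "y (Suc i) \<noteq> G (Suc i) (y i) (y (Suc (Suc i) mod n))"
        using wr[OF that] that prev_mod[of "Suc i" n] by simp
      moreover have "Suc i = n - 1 \<longleftrightarrow> Suc (Suc i) = n" using that by auto
      ultimately have "w (Suc i) \<noteq> g (w i) (w (Suc (Suc i)))"
        using that n unfolding w_def G_def by (cases "Suc (Suc i) = n") auto
      then show ?thesis unfolding d_def using that w3 by (intro key) auto
    qed
    have "d 0 \<le> d (n - 1)"
    proof -
      have yn: "y (n - 1) < 3" "y 0 < 3" "y 1 < 3" using y n by auto
      have "y 0 \<noteq> g ((y (n - 1) + 2) mod 3) (y 1)" using wr[of 0] n by (auto simp: G_def)
      then have "(y 1 + 3 - y 0) mod 3 \<le> (y 0 + 3 - (y (n - 1) + 2) mod 3) mod 3"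
        using yn by (intro key) auto
      moreover have "(b + 3 - (a + 2) mod 3) mod 3 = ((b + 1) mod 3 + 3 - a) mod 3" if "a < 3" "b < 3" for a b :: nat
        using that unfolding less_3_cases by (elim disjE) simp_all
      moreover have "d 0 = (y 1 + 3 - y 0) mod 3" "d (n - 1) = ((y 0 + 1) mod 3 + 3 - y (n - 1)) mod 3"
        using n by (simp_all add: d_def w_def)
      ultimately show ?thesis using yn by metis
    qed
    moreover have mono: "d (i + k) \<le> d i" if "i + k < n" for i k
      using that
    proof (induction k)
      case (Suc k)
      then show ?case using step[of "i + k"] by simp
    qed simp
    ultimately have d: "d i = d 0" if "i < n" for i
      using mono[of 0 i] mono[of i "n - 1 - i"] that by auto
    have "w i mod 3 = (w 0 + i * d 0) mod 3" if "i \<le> n" for i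
      using that
    proof (induction i)
      case (Suc i)
      have "(a + (c + 3 - a) mod 3) mod 3 = c mod 3" if "a < 3" "c < 3" for a c :: nat
        using that unfolding less_3_cases by (elim disjE) simp_all
      then have "w (Suc i) mod 3 = (w i + d i) mod 3" using Suc.prems w3 unfolding d_def by simp
      also have "\<dots> = (w 0 + i * d 0 + d 0) mod 3" using Suc d[of i] by (metis Suc_leD Suc_le_lessD mod_add_left_eq)
      finally show ?case by (simp add: ac_simps)
    qed simp
    from this[of n] have "(y 0 + 1) mod 3 = (y 0 + n * d 0) mod 3" using n by (simp add: w_def)
    moreover have "(y 0 + n * d 0) mod 3 = y 0 mod 3" using n(2) by (auto simp: mult.assoc)
    moreover have "(y 0 + 1) mod 3 \<noteq> y 0 mod 3" by presburger
    ultimately show False by simp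
  qed
  then show ?thesis unfolding cycle_wins_def by blast
qed

text \<open>Vertices \<open>i \<ge> 3\<close> split their colour into a left bit \<open>y i mod 2\<close> and a right bit \<open>y i div 2\<close>, and
  bits facing each other along an edge play the two-colour game on that edge. If all of them guess
  wrong then one of the two end bits of this path, at \<open>2\<close> or at \<open>0\<close>, is guessed right.\<close>

lemma cycle_wins_2_3_3:
  assumes n: "n \<ge> 3"
  shows "cycle_wins n (\<lambda>i. if i = 0 then 2 else 3)"
proof -
  define G :: "nat \<Rightarrow> nat \<Rightarrow> nat \<Rightarrow> nat" where
    "G i l r = (if i = 0 then if r = 0 then 1 - l div 2 else r - 1
      else if i = 1 then if r = 1 then 0 else if l = 1 then 1 else 2
      else if i = 2 then if l = 0 then 2 * (r mod 2) else 1
      else (1 - l div 2) + 2 * (r mod 2))" for i l r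
  have "\<exists>i<n. y i = G i (y ((i + n - 1) mod n)) (y (Suc i mod n))"
    if y: "\<forall>i<n. y i < (if i = 0 then 2 else 3)" for y
  proof (rule ccontr)
    assume "\<not> ?thesis"
    then have wr: "y i \<noteq> G i (y ((i + n - 1) mod n)) (y (Suc i mod n))" if "i < n" for i using that by blast
    have y0: "y 0 < 2" and y3: "\<And>i. 0 < i \<Longrightarrow> i < n \<Longrightarrow> y i < 3" using y[rule_format, of 0] y n by auto
    \<comment> \<open>\<open>a\<close> and \<open>b\<close> are the bits facing vertices 2 and 0;
      for \<open>n = 3\<close> they come from vertices 0 and 2 themselves.\<close>
    define a where "a = y (3 mod n) mod 2"
    define b where "b = y (n - 1) div 2"
    have path: "y (2 + k) div 2 \<noteq> y (Suc (2 + k) mod n) mod 2" if "y 2 div 2 \<noteq> a" "2 + k < n" for k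
      using that(2)
    proof (induction k)
      case 0
      then show ?case using that(1) by (simp add: a_def)
    next
      case (Suc k)
      define j where "j = Suc (2 + k)"
      have j: "j < n" "j \<ge> 3" using Suc.prems by (auto simp: j_def)
      have "y (j - 1) div 2 \<noteq> y j mod 2" using Suc j by (simp add: j_def)
      moreover have "y j \<noteq> (1 - y (j - 1) div 2) + 2 * (y (Suc j mod n) mod 2)"
        using wr[OF j(1)] j prev_mod[of j n] by (simp add: G_def)
      moreover have "y (j - 1) < 3" "y j < 3" using y3 j by auto
      ultimately have "y j div 2 \<noteq> y (Suc j mod n) mod 2"
        unfolding less_3_cases by (elim disjE) simp_all
      then show ?case by (simp add: j_def)
    qed
    have ab: "y 2 div 2 = a \<or> b \<noteq> y 0"
    proof -
      have "2 + (n - 3) = n - 1" "Suc (n - 1) = n" using n by auto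
      then have "b \<noteq> y 0 mod 2" if "y 2 div 2 \<noteq> a" using path[OF that, of "n - 3"] n by (simp add: b_def)
      then show ?thesis using y0 by auto
    qed
    have w0: "y 0 \<noteq> (if y 1 = 0 then 1 - b else y 1 - 1)" using wr[of 0] n by (auto simp: G_def b_def split: if_splits)
    have w1: "y 1 \<noteq> (if y 2 = 1 then 0 else if y 0 = 1 then 1 else 2)" using wr[of 1] n prev_mod[of 1 n] by (auto simp: G_def split: if_splits simp flip: numeral_2_eq_2)
    have w2: "y 2 \<noteq> (if y 1 = 0 then 2 * a else 1)" using wr[of 2] n prev_mod[of 2 n] by (auto simp: G_def a_def split: if_splits)
    \<comment> \<open>If vertex 1 has colour 0, then vertex 2 has colour 0 or 2 with right bit
      different from \<open>a\<close>, so \<open>b\<close> differs from \<open>y 0\<close> and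
      vertex 0 is right. If it has colour 1 or 2, then \<open>y 2\<close> is not 1 and
      \<open>y 0\<close> is not \<open>y 1 - 1\<close>, which makes vertex 1 right.\<close>
    have "y 1 < 3" "y 2 < 3" "a < 2" using y3 n by (auto simp: a_def)
    moreover have "b < 2" using y3[of "n - 1"] n unfolding b_def by auto
    ultimately show False using y0 w0 w1 w2 ab unfolding less_3_cases less_2_cases_iff
      by (elim disjE) simp_all
  qed
  then show ?thesis unfolding cycle_wins_def by blast
qed

section \<open>Winning cycles inside a larger graph\<close>

lemma rotate_cycle:
  assumes C: "C \<in> cycles E" and w: "w \<in> \<Union>C"
  shows "\<exists>xs. distinct xs \<and> length xs = card C \<and> C = closed_walk_edges xs \<and> xs ! 0 = w"
proof -
  obtain xs where xs: "distinct xs" "length xs \<ge> 3" "C = closed_walk_edges xs"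
    using C unfolding cycles_def by blast
  let ?n = "length xs"
  have n: "?n > 0" using xs(2) by linarith
  then have "w \<in> set xs" using w Union_closed_walk_edges[of xs] xs(3) by auto
  then obtain k where k: "k < ?n" "xs ! k = w" by (metis in_set_conv_nth)
  define ys where "ys = rotate k xs"
  have nth: "ys ! i = xs ! ((k + i) mod ?n)" if "i < ?n" for i using that by (simp add: ys_def nth_rotate add.commute)
  have "\<exists>j<?n. {ys ! i, ys ! (Suc i mod ?n)} = {xs ! j, xs ! (Suc j mod ?n)}" if "i < ?n" for i
  proof (intro exI[of _ "(k + i) mod ?n"] conjI)
    have "(k + Suc i mod ?n) mod ?n = Suc ((k + i) mod ?n) mod ?n" by (simp add: mod_simps)
    then show "{ys ! i, ys ! (Suc i mod ?n)} = {xs ! ((k + i) mod ?n), xs ! (Suc ((k + i) mod ?n) mod ?n)}"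
      using nth[OF that] nth[of "Suc i mod ?n"] n by simp
  qed (use n in simp)
  then have "closed_walk_edges ys \<subseteq> closed_walk_edges xs"
    unfolding closed_walk_edges_def by (auto simp: ys_def)
  moreover have "card (closed_walk_edges ys) = card (closed_walk_edges xs)"
    using card_closed_walk_edges[of ys] card_closed_walk_edges[of xs] xs(1,2) by (simp add: ys_def)
  moreover have "finite (closed_walk_edges xs)" by (simp add: closed_walk_edges_def)
  ultimately have "closed_walk_edges ys = closed_walk_edges xs" by (intro card_subset_eq)
  then show ?thesis
    using xs card_closed_walk_edges[OF xs(1,2)] nth[of 0] k n by (intro exI[of _ ys]) (auto simp: ys_def)
qed

lemma cycle_wins_at:
  assumes C: "C \<in> cycles E" and w: "w \<in> \<Union>C" and win: "cycle_wins (card C) (\<lambda>i. if i = 0 then 2 else q)"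
  shows "wins (\<Union>C) E (\<lambda>v. if v = w then 2 else q)"
proof -
  obtain xs where xs: "distinct xs" "length xs = card C" "C = closed_walk_edges xs" "xs ! 0 = w"
    using rotate_cycle[OF C w] by blast
  have ne: "xs \<noteq> []" using w xs(3) by (auto simp: closed_walk_edges_def)
  have "wins (set xs) (closed_walk_edges xs) (\<lambda>v. if v = w then 2 else q)"
    using xs win ne by (intro cycle_wins_imp_wins) (auto simp: nth_eq_iff_index_eq)
  moreover have "closed_walk_edges xs \<subseteq> E" using C xs(3) unfolding cycles_def by auto
  ultimately show ?thesis using Union_closed_walk_edges[OF ne] xs(3) wins_mono by fastforce
qed

lemma cycle_wins_all:
  assumes C: "C \<in> cycles E" and V: "simple_graph V E" and win: "cycle_wins (card C) (\<lambda>_. q)"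
  shows "wins V E (\<lambda>_. q)"
proof -
  obtain xs where xs: "distinct xs" "length xs \<ge> 3" "C = closed_walk_edges xs" "closed_walk_edges xs \<subseteq> E"
    using C unfolding cycles_def by blast
  have "wins (set xs) (closed_walk_edges xs) (\<lambda>_. q)"
    using win xs card_closed_walk_edges[OF xs(1,2)] by (intro cycle_wins_imp_wins) auto
  moreover have "set xs \<subseteq> V"
  proof -
    have "xs \<noteq> []" using xs(2) by auto
    then have "set xs = \<Union> (closed_walk_edges xs)" by (rule Union_closed_walk_edges[symmetric])
    then show ?thesis using xs(4) V unfolding simple_graph_def by blast
  qed
  ultimately show ?thesis by (rule wins_mono) (use xs(4) in auto)
qed

section \<open>Two cycles joined by a path\<close>

text \<open>\<open>U\<close> will be the vertex set of a cycle, and a path attached to it ends in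
  the tip \<open>w\<close>. It grows vertex by vertex to match the gluing of one edge at a
  time.\<close>

inductive lollipop :: "'a set set \<Rightarrow> 'a set \<Rightarrow> 'a set \<Rightarrow> 'a \<Rightarrow> bool" for E U where
  base: "w \<in> U \<Longrightarrow> lollipop E U U w"
| step: "lollipop E U H w \<Longrightarrow> {w, x} \<in> E \<Longrightarrow> x \<notin> H \<Longrightarrow> lollipop E U (insert x H) x"

lemma lollipop_tip: "lollipop E U H w \<Longrightarrow> w \<in> H"
  by (induction rule: lollipop.induct) auto

text \<open>The walk towards the second cycle may return to vertices already used; cutting the path
  back to \<open>x\<close>, or down to \<open>U\<close>, keeps the tip on the walk.\<close>

lemma lollipop_shorten:
  assumes "lollipop E U H w" "x \<in> H"
  shows "\<exists>H'. H' \<subseteq> H \<and> lollipop E U H' x"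
  using assms
proof (induction rule: lollipop.induct)
  case (base w)
  then show ?case by (intro exI[of _ U]) (simp add: lollipop.base)
next
  case (step H w y)
  show ?case
  proof (cases "x = y")
    case True
    then show ?thesis using lollipop.step[OF step.hyps] by (intro exI[of _ "insert y H"]) simp
  next
    case False
    then obtain H' where "H' \<subseteq> H" "lollipop E U H' x" using step by auto
    then show ?thesis by (intro exI[of _ H']) auto
  qed
qed

text \<open>Gluing an edge at the tip doubles the hatness 2 there and moves the hatness 2 to the new
  tip; the product 4 is where the bound on \<open>q\<close> comes from.\<close>

lemma lollipop_wins:
  assumes "lollipop E U H w" and base: "\<And>w. w \<in> U \<Longrightarrow> wins U E (\<lambda>v. if v = w then 2 else q)"
    and q: "q \<le> 4" and irr: "\<And>v. {v} \<notin> E"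
  shows "wins H E (\<lambda>v. if v = w then 2 else q)"
  using assms(1)
proof (induction rule: lollipop.induct)
  case (step H w x)
  have "w \<in> H" using lollipop_tip[OF step.hyps(1)] .
  then have wx: "w \<noteq> x" "H \<inter> {w, x} = {w}" using step.hyps(3) by auto
  have "wins (H \<union> {w, x}) E (\<lambda>v. if v = x then 2 else q)"
    by (rule wins_glue[OF step.IH wins_edge[OF step.hyps(2) wx(1)] wx(2) irr])
      (use q wx step.hyps(3) in auto)
  moreover have "H \<union> {w, x} = insert x H" using \<open>w \<in> H\<close> by auto
  ultimately show ?case by simp
qed (rule base)

lemma two_cycles_win:
  assumes G: "simple_graph V E" "connected_graph V E" and q: "q \<le> 4"
    and V: "U \<subseteq> V" "W \<subseteq> V" "U \<noteq> {}" "W \<noteq> {}" and UW: "card (U \<inter> W) \<le> 1"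
    and U: "\<And>w. w \<in> U \<Longrightarrow> wins U E (\<lambda>v. if v = w then 2 else q)"
    and W: "\<And>w. w \<in> W \<Longrightarrow> wins W E (\<lambda>v. if v = w then 2 else q)"
  shows "wins V E (\<lambda>_. q)"
proof -
  have irr: "{v} \<notin> E" for v using G(1) unfolding simple_graph_def by fastforce
  have EV: "x \<in> V" if "{w, x} \<in> E" for w x using G(1) that unfolding simple_graph_def by blast
  have finV: "finite V" using G(1) unfolding simple_graph_def by blast
  have glue: "wins V E (\<lambda>_. q)" if "wins H E (\<lambda>v. if v = w then 2 else q)" "H \<inter> W = {w}" "H \<subseteq> V" for H w
  proof -
    have "w \<in> W" using that(2) by auto
    have "wins (H \<union> W) E (\<lambda>_. q)"
      by (rule wins_glue[OF that(1) W[OF \<open>w \<in> W\<close>] that(2) irr]) (use q in auto)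
    then show ?thesis by (rule wins_mono) (use that(3) V(2) in auto)
  qed
  show ?thesis
  proof (cases "U \<inter> W = {}")
    case False
    then have "card (U \<inter> W) = 1" using UW finite_subset[OF V(1) finV] by (simp add: le_Suc_eq)
    then obtain w where w: "U \<inter> W = {w}" by (auto simp: card_1_singleton_iff)
    then show ?thesis using glue[OF U w V(1)] by blast
  next
    case True
    obtain a b where ab: "a \<in> U" "b \<in> W" using V(3,4) by blast
    then have "(a, b) \<in> (adj E)\<^sup>*" using G(2) V(1,2) unfolding connected_graph_def by blast
    \<comment> \<open>Invariant along the walk from \<open>U\<close> to \<open>W\<close>: unless the
      game on \<open>V\<close> is already won, some lollipop avoiding \<open>W\<close> has its tip
      at the current vertex. On entering \<open>W\<close> the lollipop meets it in the tip only,
      where gluing allows 2 times 2 colours. At the end the tip \<open>b\<close> lies in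
      \<open>W\<close>, so only the win remains.\<close>
    then have "wins V E (\<lambda>_. q) \<or> (\<exists>H. lollipop E U H b \<and> H \<inter> W = {} \<and> H \<subseteq> V)"
    proof (induction rule: rtrancl_induct)
      case base
      show ?case using lollipop.base[OF ab(1)] True V(1) by blast
    next
      case (step w x)
      show ?case
      proof (cases "wins V E (\<lambda>_. q)")
        case False
        then obtain H where H: "lollipop E U H w" "H \<inter> W = {}" "H \<subseteq> V" using step.IH by blast
        have wx: "{w, x} \<in> E" using step.hyps(2) by simp
        show ?thesis
        proof (cases "x \<in> H")
          case True
          then show ?thesis using lollipop_shorten[OF H(1) True] H by blast
        next
          case xH: False
          have L: "lollipop E U (insert x H) x" using lollipop.step[OF H(1) wx xH] .
          show ?thesis
          proof (cases "x \<in> W")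
            case True
            then have "wins V E (\<lambda>_. q)"
              using glue[OF lollipop_wins[OF L U q irr]] H(2,3) EV[OF wx] by blast
            then show ?thesis ..
          next
            case False
            then show ?thesis using L H EV[OF wx] by blast
          qed
        qed
      qed simp
    qed
    moreover have "b \<in> H" if "lollipop E U H b" for H using lollipop_tip[OF that] .
    ultimately show ?thesis using ab(2) by (metis disjoint_iff)
  qed
qed

lemma two_cycles_in_cactus_win:
  assumes G: "simple_graph V E" "connected_graph V E" "cactus_cycles E" and q: "q \<le> 4"
    and C: "C \<in> cycles E" "D \<in> cycles E" "C \<noteq> D"
    and win: "cycle_wins (card C) (\<lambda>i. if i = 0 then 2 else q)" "cycle_wins (card D) (\<lambda>i. if i = 0 then 2 else q)"
  shows "wins V E (\<lambda>_. q)"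
proof (rule two_cycles_win[OF G(1,2) q])
  have cyc: "\<Union>B \<subseteq> V \<and> \<Union>B \<noteq> {}" if B: "B \<in> cycles E" for B
  proof -
    obtain xs where xs: "length xs \<ge> 3" "B = closed_walk_edges xs" "B \<subseteq> E" using B unfolding cycles_def by blast
    have ne: "xs \<noteq> []" using xs(1) by auto
    have "\<Union>B \<noteq> {}" using Union_closed_walk_edges[OF ne] xs(2) ne by simp
    moreover have "\<Union>B \<subseteq> V" using xs(3) G(1) unfolding simple_graph_def by blast
    ultimately show ?thesis by blast
  qed
  show "\<Union>C \<subseteq> V" "\<Union>D \<subseteq> V" "\<Union>C \<noteq> {}" "\<Union>D \<noteq> {}" using cyc C by blast+
  show "card (\<Union>C \<inter> \<Union>D) \<le> 1" using G(3) C unfolding cactus_cycles_def by blast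
  show "wins (\<Union>C) E (\<lambda>v. if v = w then 2 else q)" if "w \<in> \<Union>C" for w
    by (rule cycle_wins_at[OF C(1) that win(1)])
  show "wins (\<Union>D) E (\<lambda>v. if v = w then 2 else q)" if "w \<in> \<Union>D" for w
    by (rule cycle_wins_at[OF C(2) that win(2)])
qed

section \<open>The hat guessing number of a cactus\<close>

text \<open>A win with more colours gives one with fewer, so losing with \<open>Suc q\<close> rules
  out every larger value.\<close>

lemma HG_eq:
  assumes G: "simple_graph V E" and q: "q \<ge> 1" and win: "wins V E (\<lambda>_. q)" and lose: "\<not> wins V E (\<lambda>_. Suc q)"
  shows "HG V E = q"
  unfolding HG_def
proof (rule Greatest_equality)
  show "1 \<le> q \<and> winning V E (\<lambda>_. q)" using q win winning_iff_wins[OF G] by simp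
  fix p assume p: "1 \<le> p \<and> winning V E (\<lambda>_. p)"
  show "p \<le> q"
  proof (rule ccontr)
    assume "\<not> p \<le> q"
    then have "wins V E (\<lambda>_. Suc q)"
      using p winning_iff_wins[OF G] wins_mono[of V E "\<lambda>_. p" V E "\<lambda>_. Suc q"] by simp
    then show False using lose by blast
  qed
qed

lemma two_distinct:
  assumes "card A \<ge> 2"
  shows "\<exists>x\<in>A. \<exists>y\<in>A. x \<noteq> y"
proof (rule ccontr)
  assume "\<not> ?thesis"
  then have "card A \<le> Suc 0" using card_le_Suc0_iff_eq[of A] card.infinite[of A] by (cases "finite A") auto
  then show False using assms by simp
qed

lemma card_cycle_ge_3: "C \<in> cycles E \<Longrightarrow> card C \<ge> 3"
  using card_closed_walk_edges unfolding cycles_def by fastforce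

theorem theorem1p2:
  fixes V :: "'a set" and E :: "'a set set"
  assumes "simple_graph V E" and "cactus V E"
  shows "(HG V E = 4 \<longleftrightarrow> card (triangles E) \<ge> 2) \<and>
    (HG V E = 3 \<longleftrightarrow>
      (card (cycles E) \<ge> 2 \<or> (\<exists>C\<in>cycles E. card C = 4 \<or> 3 dvd card C)) \<and>
      card (triangles E) < 2) \<and>
    (HG V E = 2 \<longleftrightarrow>
      (pseudotree V E \<and> E \<noteq> {}) \<and> \<not> (\<exists>C\<in>cycles E. card C = 4 \<or> 3 dvd card C))"
proof -
  have con: "connected_graph V E" and cac: "cactus_cycles E"
    using assms(2) unfolding cactus_def cactus_cycles_def by blast+
  note G = assms(1) con cac
  obtain v where v: "v \<in> V" using con unfolding connected_graph_def by blast
  have "finite E" using assms(1) unfolding simple_graph_def by (meson PowI finite_Pow_iff finite_subset subsetI)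
  moreover have "cycles E \<subseteq> Pow E" unfolding cycles_def by blast
  ultimately have fin: "finite (cycles E)" using finite_subset by blast
  have tri: "triangles E \<subseteq> cycles E" unfolding triangles_def by blast
  let ?good = "\<exists>C\<in>cycles E. card C = 4 \<or> 3 dvd card C"
  have pseudo: "pseudotree V E \<longleftrightarrow> card (cycles E) \<le> 1" using con unfolding pseudotree_def by blast
  have two: "cycle_loses_rooted q 2" if "q \<ge> 3" for q by (rule cycle_loses_rooted_2[OF that])
  have lose5: "\<not> wins V E (\<lambda>_. 5)"
  proof (rule loses_rooted_not_wins[OF cactus_loses_rooted[OF G _ _ v]])
    fix C assume "C \<in> cycles E"
    then have "card C = 3 \<or> card C \<ge> 4" using card_cycle_ge_3 by force
    then show "cycle_loses_rooted 5 (card C)" using cycle_loses_rooted_3[of 5] cycle_loses_rooted_ge_4[of 5] by auto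
  qed (use two in auto)
  have lose4: "\<not> wins V E (\<lambda>_. 4)" if t: "card (triangles E) < 2"
  proof -
    have ge4: "cycle_loses_rooted 4 (card C)" if "C \<in> cycles E" "C \<notin> triangles E" for C
      using cycle_loses_rooted_ge_4[of 4 "card C"] card_cycle_ge_3[OF that(1)] that unfolding triangles_def by force
    show ?thesis
    proof (cases "triangles E = {}")
      case True
      show ?thesis
        by (rule loses_rooted_not_wins[OF cactus_loses_rooted[OF G _ _ v]]) (use ge4 True two in auto)
    next
      case False
      \<comment> \<open>The only triangle is the exceptional cycle at which the reduction
        ends.\<close>
      then obtain T where T: "T \<in> triangles E" by blast
      have uniq: "D = T" if "D \<in> triangles E" for D
        using t T that card_le_Suc0_iff_eq[OF finite_subset[OF tri fin]] by simp
      show ?thesis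
      proof (rule cactus_loses_at_cycle[OF G])
        show "T \<in> cycles E" using T tri by blast
        show "cycle_loses 4 (card T)" using T cycle_loses_4_3 unfolding triangles_def by simp
        show "cycle_loses_rooted 4 (card D)" if "D \<in> cycles E" "D \<noteq> T" for D
          using ge4 uniq that by blast
      qed (use two in auto)
    qed
  qed
  have lose3: "\<not> wins V E (\<lambda>_. 3)" if c: "card (cycles E) < 2" "\<not> ?good"
  proof (cases "cycles E = {}")
    case True
    show ?thesis
      by (rule loses_rooted_not_wins[OF cactus_loses_rooted[OF G _ _ v]]) (use True two in auto)
  next
    case False
    then obtain C where C: "C \<in> cycles E" by blast
    have uniq: "D = C" if "D \<in> cycles E" for D
      using c(1) C that card_le_Suc0_iff_eq[OF fin] by simp
    have nd: "card C \<noteq> 4" "\<not> 3 dvd card C" using c(2) C by blast+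
    then have "card C \<noteq> 3" by auto
    then have "card C \<ge> 5" using nd(1) card_cycle_ge_3[OF C] by linarith
    then have "cycle_loses 3 (card C)" using cycle_loses_3 nd(2) by blast
    then show ?thesis using cactus_loses_at_cycle[OF G C] uniq two[of 3] by blast
  qed
  have win4: "wins V E (\<lambda>_. 4)" if t: "card (triangles E) \<ge> 2"
  proof -
    obtain C D where CD: "C \<in> triangles E" "D \<in> triangles E" "C \<noteq> D" using two_distinct[OF t] by blast
    then have "cycle_wins (card C) (\<lambda>i. if i = 0 then 2 else 4)" "cycle_wins (card D) (\<lambda>i. if i = 0 then 2 else 4)"
      using cycle_wins_2_4_4 unfolding triangles_def by simp_all
    moreover have "C \<in> cycles E" "D \<in> cycles E" using CD tri by blast+
    ultimately show ?thesis using two_cycles_in_cactus_win[OF G, of 4 C D] CD(3) by simp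
  qed
  have win3: "wins V E (\<lambda>_. 3)" if "card (cycles E) \<ge> 2 \<or> ?good"
    using that
  proof
    assume "card (cycles E) \<ge> 2"
    then obtain C D where CD: "C \<in> cycles E" "D \<in> cycles E" "C \<noteq> D" using two_distinct by blast
    then show ?thesis using two_cycles_in_cactus_win[OF G, of 3 C D]
        cycle_wins_2_3_3[OF card_cycle_ge_3[OF CD(1)]] cycle_wins_2_3_3[OF card_cycle_ge_3[OF CD(2)]] by simp
  next
    assume ?good
    then obtain C where C: "C \<in> cycles E" "card C = 4 \<or> 3 dvd card C" by blast
    then have "cycle_wins (card C) (\<lambda>_. 3)"
      using cycle_wins_4_3 cycle_wins_3_dvd card_cycle_ge_3[OF C(1)] by auto
    then show ?thesis using cycle_wins_all[OF C(1) assms(1)] by blast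
  qed
  have win2: "wins V E (\<lambda>_. 2)" if "E \<noteq> {}"
  proof -
    obtain e where "e \<in> E" using \<open>E \<noteq> {}\<close> by blast
    then obtain a b where ab: "{a, b} \<in> E" "a \<noteq> b" "{a, b} \<subseteq> V"
      using assms(1) unfolding simple_graph_def by (metis card_2_iff)
    show ?thesis by (rule wins_mono[OF wins_edge[OF ab(1,2)] ab(3)]) auto
  qed
  \<comment> \<open>Case 1 is the single vertex: it loses with 2 colours, \<open>HG\<close> is 1,
    and both sides of each of the three equivalences are false.\<close>
  consider (4) "card (triangles E) \<ge> 2" | (3) "card (triangles E) < 2" "card (cycles E) \<ge> 2 \<or> ?good"
    | (2) "card (cycles E) < 2" "\<not> ?good" "E \<noteq> {}" | (1) "card (cycles E) < 2" "\<not> ?good" "E = {}"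
    using not_le by blast
  then show ?thesis
  proof cases
    case 4
    have "HG V E = 4" by (rule HG_eq[OF assms(1)]) (use win4[OF 4] lose5 in auto)
    moreover have "card (cycles E) \<ge> 2" using 4 card_mono[OF fin tri] by linarith
    ultimately show ?thesis using 4 pseudo by auto
  next
    case 3
    have "HG V E = 3" by (rule HG_eq[OF assms(1)]) (use win3[OF 3(2)] lose4[OF 3(1)] in auto)
    then show ?thesis using 3 pseudo by auto
  next
    case 2
    have "HG V E = 2" by (rule HG_eq[OF assms(1)]) (use win2[OF 2(3)] lose3[OF 2(1,2)] in auto)
    moreover have "card (triangles E) < 2" using 2(1) card_mono[OF fin tri] by linarith
    ultimately show ?thesis using 2 pseudo by auto
  next
    case 1
    have "wins V E (\<lambda>_. 1)"
      by (rule winsI[of _ _ "\<lambda>_ _. 0"]) (use v in \<open>auto simp: sees_neighbors_def\<close>)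
    moreover have "\<not> wins V E (\<lambda>_. 2)"
      using loses_rooted_not_wins[OF loses_rooted_trivial[of V v 2]] con v 1(3) by simp
    ultimately have "HG V E = 1" by (intro HG_eq[OF assms(1)]) (simp_all flip: numeral_2_eq_2)
    moreover have "card (triangles E) < 2" using 1(1) card_mono[OF fin tri] by linarith
    ultimately show ?thesis using 1 by auto
  qed
qed

end
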